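(* Let $(\bar\xi,\bar x)\in\operatorname{gph}E$ with $\bar\xi\in\Omega$ be a local solution to (MPEC), and let $\rho>0$. Suppose that: (i) $\varphi$ is locally Lipschitz around $(\bar\xi,\bar x)$; (ii) $K$ is continuous (lower and upper semicontinuous); (iii) $\widetilde\Omega$ and $\operatorname{gph}E$ are subtransversal at $(\bar\xi,\bar x)$; (iv) $f$ is $C$-u.s.c.; (v) $-\partial^\infty\nu(\bar\xi,\bar x)\cap\big(D^*K(\bar\xi,\bar x)(\mathbb B)\times\mathbb B\big)=\{0\}$; (vi) for every $\xi\in\mathbb B(\bar\xi,\rho)$ there exists $x_{0,\xi}\in K(\xi)$ such that $f(\xi,x_{0,\xi},K(\xi))$ is $C$-bounded; (vii) there exists $\gamma>0$ such that $$\big[\partial_x\nu(\xi,x)+N^\flat(x;K(\xi))\big]\cap\gamma\mathbb B=\emptyset\quad\forall x\in\mathbb R^n\setminus E(\xi),\ \forall\xi\in\mathbb B(\bar\xi,\rho).$$ Then there exists $\lambda>0$ such that $$0\in\partial\varphi(\bar\xi,\bar x)+\lambda\big[(N(\bar\xi;\Omega)\cap\mathbb B)\times\{0\}\big]+\frac{\lambda}{\gamma}\Big[\partial\nu(\bar\xi,\bar x)+\big(D^*K(\bar\xi,\bar x)(\mathbb B)\times\mathbb B\big)\Big].$$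
   Context: $C\subset\mathbb R^m$ nontrivial closed convex pointed cone; $f:\mathbb R^p\times\mathbb R^n\times\mathbb R^n\to\mathbb R^m$; $K:\mathbb R^p\rightrightarrows\mathbb R^n$ has closed graph and nonempty values everywhere. VEP($\xi$): find $x\in K(\xi)$ with $f(\xi,x,z)\in C$ for all $z\in K(\xi)$; $E(\xi)$ its solution set. $\nu(\xi,x)=\sup_{z\in K(\xi)}\operatorname{dist}(f(\xi,x,z),C)$, $\mu(\xi,x)=\operatorname{dist}(x,K(\xi))$, $\mathfrak m=\nu+\mu$. (MPEC): minimize $\varphi(\xi,x)$ s.t. $x\in E(\xi)$, $\xi\in\Omega$, with $\varphi:\mathbb R^p\times\mathbb R^n\to\mathbb R$, $\Omega\subseteq\mathbb R^p$ closed; $\widetilde\Omega=\Omega\times\mathbb R^n$. Subtransversality of $S_1,S_2$ at $\bar s$: there exist $\kappa,r>0$ with $\operatorname{dist}(w,S_1\cap S_2)\le\kappa\max\{\operatorname{dist}(w,S_1),\operatorname{dist}(w,S_2)\}$ for all $w\in\mathbb B(\bar s,r)$. $C$-u.s.c.: for every neighbourhood $V$ of $f(u_0)$ there is a neighbourhood $U$ of $u_0$ with $f(u)\in V-C$ on $U$. $S$ is $C$-bounded if $S\setminus C$ is bounded. $\Pi(x;S)$ Euclidean projection set; basic normal cone $N(\bar x;S)=\operatorname{Limsup}_{x\to\bar x}\operatorname{cone}[x-\Pi(x;S)]$; coderivative $D^*F(\bar x,\bar y)(v)=\{u:(u,-v)\in N((\bar x,\bar y);\operatorname{gph}F)\}$,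 $D^*F(\bar x,\bar y)(V)=\bigcup_{v\in V}D^*F(\bar x,\bar y)(v)$; basic subdifferential $\partial\psi(\bar x)=\{v:(v,-1)\in N((\bar x,\psi(\bar x));\operatorname{epi}\psi)\}$, singular subdifferential $\partial^\infty\psi(\bar x)=\{v:(v,0)\in N((\bar x,\psi(\bar x));\operatorname{epi}\psi)\}$; $\partial_x$ denotes the partial basic subdifferential in $x$. Unit truncation map: $N^\flat(x;K(\xi))=N(x;K(\xi))\cap\mathbb B$ if $x\in K(\xi)$, and $\{(x-z)/\operatorname{dist}(x,K(\xi)):z\in\Pi(x;K(\xi))\}$ otherwise. $\mathbb B$ closed unit ball (in the appropriate space). *)

theory Defs
  imports "HOL-Analysis.Analysis"
begin

definition proj_set :: "'a::euclidean_space \<Rightarrow> 'a set \<Rightarrow> 'a set" where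
  "proj_set x S = {z \<in> S. dist x z = infdist x S}"

definition proj_cone :: "'a::euclidean_space set \<Rightarrow> 'a \<Rightarrow> 'a set" where
  "proj_cone S x = {t *\<^sub>R (x - z) | t z. t \<ge> 0 \<and> z \<in> proj_set x S}"

definition basic_normal :: "'a::euclidean_space \<Rightarrow> 'a set \<Rightarrow> 'a set" where
  "basic_normal xbar S =
     (if xbar \<in> S then
        {v. \<exists>xs vs. xs \<longlonglongrightarrow> xbar \<and> vs \<longlonglongrightarrow> v \<and> (\<forall>k. vs k \<in> proj_cone S (xs k))}
      else {})"

definition graph :: "('a \<Rightarrow> 'b set) \<Rightarrow> ('a \<times> 'b) set" where
  "graph F = {(x, y). y \<in> F x}"

definition coderiv ::
  "('a::euclidean_space \<Rightarrow> 'b::euclidean_space set) \<Rightarrow> 'a \<Rightarrow> 'b \<Rightarrow> 'b \<Rightarrow> 'a set" where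
  "coderiv F xbar ybar v = {u. (u, - v) \<in> basic_normal (xbar, ybar) (graph F)}"

definition coderiv_set ::
  "('a::euclidean_space \<Rightarrow> 'b::euclidean_space set) \<Rightarrow> 'a \<Rightarrow> 'b \<Rightarrow> 'b set \<Rightarrow> 'a set" where
  "coderiv_set F xbar ybar V = (\<Union>v\<in>V. coderiv F xbar ybar v)"

definition epi :: "('a \<Rightarrow> ereal) \<Rightarrow> ('a \<times> real) set" where
  "epi \<psi> = {(x, t). \<psi> x \<le> ereal t}"

definition basic_subdiff :: "('a::euclidean_space \<Rightarrow> ereal) \<Rightarrow> 'a \<Rightarrow> 'a set" where
  "basic_subdiff \<psi> xbar =
     (if \<bar>\<psi> xbar\<bar> = \<infinity> then {}
      else {v. (v, -1) \<in> basic_normal (xbar, real_of_ereal (\<psi> xbar)) (epi \<psi>)})"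

definition singular_subdiff :: "('a::euclidean_space \<Rightarrow> ereal) \<Rightarrow> 'a \<Rightarrow> 'a set" where
  "singular_subdiff \<psi> xbar =
     (if \<bar>\<psi> xbar\<bar> = \<infinity> then {}
      else {v. (v, 0) \<in> basic_normal (xbar, real_of_ereal (\<psi> xbar)) (epi \<psi>)})"

definition sol_set ::
  "('a \<Rightarrow> 'b \<Rightarrow> 'b \<Rightarrow> 'c) \<Rightarrow> 'c set \<Rightarrow> ('a \<Rightarrow> 'b set) \<Rightarrow> 'a \<Rightarrow> 'b set" where
  "sol_set f C K \<xi> = {x \<in> K \<xi>. \<forall>z\<in>K \<xi>. f \<xi> x z \<in> C}"

definition gap_nu ::
  "('a \<Rightarrow> 'b \<Rightarrow> 'b \<Rightarrow> 'c::euclidean_space) \<Rightarrow> 'c set \<Rightarrow> ('a \<Rightarrow> 'b set) \<Rightarrow> 'a \<times> 'b \<Rightarrow> ereal" where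
  "gap_nu f C K = (\<lambda>(\<xi>, x). SUP z\<in>K \<xi>. ereal (infdist (f \<xi> x z) C))"

definition trunc_normal :: "'a::euclidean_space \<Rightarrow> 'a set \<Rightarrow> 'a set" where
  "trunc_normal x S =
     (if x \<in> S then basic_normal x S \<inter> cball 0 1
      else {(1 / infdist x S) *\<^sub>R (x - z) | z. z \<in> proj_set x S})"

definition subtransversal :: "'a::euclidean_space set \<Rightarrow> 'a set \<Rightarrow> 'a \<Rightarrow> bool" where
  "subtransversal S1 S2 s \<longleftrightarrow>
     (\<exists>\<kappa> r. \<kappa> > 0 \<and> r > 0 \<and>
        (\<forall>w\<in>cball s r. infdist w (S1 \<inter> S2) \<le> \<kappa> * max (infdist w S1) (infdist w S2)))"

definition C_usc :: "'c::euclidean_space set \<Rightarrow> ('u::topological_space \<Rightarrow> 'c) \<Rightarrow> bool" where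
  "C_usc C g \<longleftrightarrow>
     (\<forall>u0 V. open V \<and> g u0 \<in> V \<longrightarrow>
        (\<exists>U. open U \<and> u0 \<in> U \<and> (\<forall>u\<in>U. g u \<in> {v - c | v c. v \<in> V \<and> c \<in> C})))"

definition C_bounded :: "'c::euclidean_space set \<Rightarrow> 'c set \<Rightarrow> bool" where
  "C_bounded C S \<longleftrightarrow> bounded (S - C)"

definition usc_map :: "('a::topological_space \<Rightarrow> 'b::topological_space set) \<Rightarrow> bool" where
  "usc_map F \<longleftrightarrow> (\<forall>x V. open V \<and> F x \<subseteq> V \<longrightarrow>
      (\<exists>U. open U \<and> x \<in> U \<and> (\<forall>x'\<in>U. F x' \<subseteq> V)))"

definition lsc_map :: "('a::topological_space \<Rightarrow> 'b::topological_space set) \<Rightarrow> bool" where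
  "lsc_map F \<longleftrightarrow> (\<forall>x V. open V \<and> F x \<inter> V \<noteq> {} \<longrightarrow>
      (\<exists>U. open U \<and> x \<in> U \<and> (\<forall>x'\<in>U. F x' \<inter> V \<noteq> {})))"

definition local_sol_MPEC ::
  "('a::euclidean_space \<times> 'b::euclidean_space \<Rightarrow> real) \<Rightarrow> ('a \<Rightarrow> 'b set) \<Rightarrow> 'a set \<Rightarrow> 'a \<Rightarrow> 'b \<Rightarrow> bool" where
  "local_sol_MPEC \<phi> E \<Omega> \<xi>0 x0 \<longleftrightarrow>
     \<xi>0 \<in> \<Omega> \<and> x0 \<in> E \<xi>0 \<and>
     (\<exists>r>0. \<forall>\<xi> x. \<xi> \<in> \<Omega> \<and> x \<in> E \<xi> \<and> (\<xi>, x) \<in> ball (\<xi>0, x0) r \<longrightarrow> \<phi> (\<xi>0, x0) \<le> \<phi> (\<xi>, x))"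

end

(* A nearest-point argument turns the proximal normals used to define the basic normal cone into
   quadratic inequalities (prox_normal). Minimising sum g_i(x_i) + k * (spread of the x_i) over
   independent copies x_i of the variable, k -> infinity, gives proximal normals to the epigraphs
   of the g_i whose sum tends to 0. Dividing by 1 + (their size) makes the limit always exist: its
   scale s is positive in the subdifferential case, and s = 0 produces singular subgradients.

   With gamma |x - xh| as third term, this rule and (vii) yield the error bound
   gamma dist(x, E(xi)) <= nu + mu. Subtransversality then makes (xi0, x0) a local minimiser of
   phi + lam dist(., Omega x R^n) + (lam/gamma) (nu + mu), and the rule applied to these four
   terms is the assertion; (v) excludes s = 0. *)

theory Submission
  imports Defs
begin

section \<open>Proximal normals\<close>

text \<open>The obstacle is that two of the four terms escape a Lipschitz sum rule: nu is only known
  to be lower semicontinuous and may be infinite, and the distance from x to K(xi) is 1-Lipschitz in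
  x but has no modulus in xi. Every term therefore enters through its epigraph, and heights t above
  the graph stand in for values. The price is that the multipliers 2k(x_i - mean) may blow up. A
  Lipschitz term contributes at most s times a constant to the limit, so for s = 0 the contributions
  of phi and of the distance to Omega x R^n vanish, and so does the x-component of the one of K.
  What is left is a singular subgradient of nu and its negative, which is normal to gph K and has
  x-component 0; this is the pair that (v) forbids. For s > 0 the same bound on the x-component puts
  the contribution of K into D*K(B) x B after rescaling.\<close>

text \<open>The inequality is anchored at a point of the set and is local, unlike
  \<open>proj_cone\<close>, which starts from the projected point. In this form a normal can be read
  off from the minimality of a smooth quadratic function on \<open>S\<close>.\<close>

definition prox_normal :: "'a::real_inner \<Rightarrow> 'a set \<Rightarrow> 'a set" where
  "prox_normal z S = {v. z \<in> S \<and> (\<exists>c>0. \<exists>\<delta>>0. \<forall>y\<in>S. dist y z < \<delta> \<longrightarrow> v \<bullet> (y - z) \<le> c * (dist y z)\<^sup>2)}"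

text \<open>For small \<open>t\<close> the ball about \<open>z + t v\<close> through
  \<open>z\<close> is so strongly curved that the quadratic inequality keeps \<open>S\<close> out of
  its interior. So \<open>z\<close> is a nearest point, and \<open>v\<close> is a multiple of the
  residual.\<close>

lemma prox_normal_imp_proj_cone:
  fixes z :: "'a::euclidean_space"
  assumes v: "v \<in> prox_normal z S" and e: "e > 0"
  shows "\<exists>x. dist x z < e \<and> v \<in> proj_cone S x"
proof -
  obtain c \<delta> where z: "z \<in> S" and c: "c > 0" and \<delta>: "\<delta> > 0"
    and le: "\<And>y. y \<in> S \<Longrightarrow> dist y z < \<delta> \<Longrightarrow> v \<bullet> (y - z) \<le> c * (dist y z)\<^sup>2"
    using v by (auto simp: prox_normal_def)
  \<comment> \<open>The first bound lets the quadratic term be absorbed, the second makes points of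
    \<open>S\<close> at distance at least \<open>\<delta>\<close> from \<open>z\<close> too remote
    to compete, the third keeps the centre within \<open>e\<close>. Adding 1 to
    \<open>norm v\<close> covers \<open>v = 0\<close>.\<close>
  define t where "t = min (1 / (2 * c)) (min (\<delta> / (2 * (norm v + 1))) (e / (2 * (norm v + 1))))"
  have np: "norm v + 1 > 0" by (simp add: add_nonneg_pos)
  have t: "t > 0" "2 * t * c \<le> 1"
    using c \<delta> e np by (auto simp: t_def min_def field_simps)
  have "t * norm v < \<delta> / 2" "t * norm v < e"
  proof -
    have "t * norm v < t * (norm v + 1)" using t by simp
    moreover have "t \<le> \<delta> / (2 * (norm v + 1))" "t \<le> e / (2 * (norm v + 1))" by (auto simp: t_def)
    then have "t * (norm v + 1) \<le> \<delta> / 2" "t * (norm v + 1) \<le> e / 2"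
      using np by (auto simp: field_simps)
    ultimately show "t * norm v < \<delta> / 2" "t * norm v < e" using e by linarith+
  qed
  note small = this
  let ?x = "z + t *\<^sub>R v"
  have closest: "dist ?x z \<le> dist ?x y" if y: "y \<in> S" for y
  proof (cases "dist y z < \<delta>")
    case True
    have "(norm (?x - y))\<^sup>2 = (dist y z)\<^sup>2 - 2 * t * (v \<bullet> (y - z)) + (t * norm v)\<^sup>2"
      by (simp add: dist_norm power2_norm_eq_inner power_mult_distrib inner_diff_left inner_diff_right
          inner_add_left inner_add_right inner_commute algebra_simps)
        (simp add: power2_eq_square)
    moreover have "2 * t * (v \<bullet> (y - z)) \<le> 2 * t * (c * (dist y z)\<^sup>2)"
      using le[OF y True] t by (intro mult_left_mono) auto
    moreover have "2 * t * (c * (dist y z)\<^sup>2) \<le> (dist y z)\<^sup>2"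
      using mult_right_mono[OF t(2), of "(dist y z)\<^sup>2"] by (simp add: algebra_simps)
    ultimately have "(t * norm v)\<^sup>2 \<le> (norm (?x - y))\<^sup>2" by linarith
    then have "t * norm v \<le> norm (?x - y)" by (rule power2_le_imp_le) simp
    then show ?thesis using t by (simp add: dist_norm)
  next
    case False
    have "dist y z \<le> dist ?x y + dist ?x z" by (metis dist_commute dist_triangle2)
    moreover have "dist ?x z = t * norm v" using t by (simp add: dist_norm)
    ultimately show ?thesis using small False by linarith
  qed
  have "infdist ?x S = dist ?x z"
    using z closest by (intro antisym infdist_le) (auto simp: infdist_def intro!: cINF_greatest)
  then have "z \<in> proj_set ?x S" using z by (simp add: proj_set_def)
  moreover have "v = (1 / t) *\<^sub>R (?x - z)" using t by simp
  ultimately have "v \<in> proj_cone S ?x" unfolding proj_cone_def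
    using t by (smt (verit) divide_nonneg_pos mem_Collect_eq)
  moreover have "dist ?x z < e" using small t by (simp add: dist_norm)
  ultimately show ?thesis by blast
qed

text \<open>Each proximal normal is realised by a projection from a point within 1/(k+1) of
  \<open>zs k\<close>, so the projected points have the same limit. Membership of \<open>z\<close>
  is assumed because \<open>basic_normal\<close> is empty off the set.\<close>

lemma basic_normal_limit:
  fixes z :: "'a::euclidean_space"
  assumes "z \<in> S" and zs: "zs \<longlonglongrightarrow> z" and vs: "vs \<longlonglongrightarrow> v"
    and pn: "\<And>k. vs k \<in> prox_normal (zs k) S"
  shows "v \<in> basic_normal z S"
proof -
  have "\<forall>k. \<exists>x. dist x (zs k) < 1 / real (Suc k) \<and> vs k \<in> proj_cone S x"
    using prox_normal_imp_proj_cone[OF pn] by simp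
  then obtain xs where xs: "\<And>k. dist (xs k) (zs k) < 1 / real (Suc k)"
    and cone: "\<And>k. vs k \<in> proj_cone S (xs k)"
    by metis
  have "(\<lambda>k. dist (xs k) (zs k)) \<longlonglongrightarrow> 0"
    by (rule tendsto_sandwich[OF _ _ tendsto_const lim_inverse_n'[THEN LIMSEQ_Suc]])
      (use xs[THEN less_imp_le] in auto)
  then have "(\<lambda>k. xs k - zs k) \<longlonglongrightarrow> 0"
    by (simp add: dist_norm tendsto_norm_zero_iff)
  from tendsto_add[OF this zs] have "xs \<longlonglongrightarrow> z" by simp
  with assms cone show ?thesis unfolding basic_normal_def by auto
qed

lemma basic_normal_scale:
  assumes "v \<in> basic_normal z S" "c \<ge> 0"
  shows "c *\<^sub>R v \<in> basic_normal z S"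
proof -
  have zS: "z \<in> S" using assms(1) by (auto simp: basic_normal_def split: if_splits)
  then obtain xs vs where 1: "xs \<longlonglongrightarrow> z" "vs \<longlonglongrightarrow> v" "\<And>k. vs k \<in> proj_cone S (xs k)"
    using assms(1) by (auto simp: basic_normal_def)
  have "c *\<^sub>R vs k \<in> proj_cone S (xs k)" for k
    using 1(3)[of k] assms(2) unfolding proj_cone_def by (smt (verit) mem_Collect_eq mult_nonneg_nonneg scaleR_scaleR)
  moreover have "(\<lambda>k. c *\<^sub>R vs k) \<longlonglongrightarrow> c *\<^sub>R v" by (intro tendsto_intros 1)
  ultimately show ?thesis using 1(1) zS unfolding basic_normal_def by auto
qed

text \<open>Along the segment the inequality reads t (v . d) <= c t^2 |d|^2; divide by t and let t
  tend to 0.\<close>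

lemma prox_normal_direction:
  assumes v: "v \<in> prox_normal z S" and e: "e > 0"
    and S: "\<And>t. 0 < t \<Longrightarrow> t < e \<Longrightarrow> z + t *\<^sub>R d \<in> S"
  shows "v \<bullet> d \<le> 0"
proof -
  obtain c \<delta> where c: "c > 0" and \<delta>: "\<delta> > 0"
    and le: "\<And>y. y \<in> S \<Longrightarrow> dist y z < \<delta> \<Longrightarrow> v \<bullet> (y - z) \<le> c * (dist y z)\<^sup>2"
    using v by (auto simp: prox_normal_def)
  define t0 where "t0 = min e (\<delta> / (norm d + 1))"
  have np: "norm d + 1 > 0" by (simp add: add_nonneg_pos)
  have t0: "t0 > 0" using e \<delta> np by (simp add: t0_def)
  have *: "v \<bullet> d \<le> t * (c * (norm d)\<^sup>2)" if t: "0 < t" "t < t0" for t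
  proof -
    have "t * norm d \<le> t * (norm d + 1)" using t by simp
    also have "\<dots> < \<delta>" using t np by (auto simp: t0_def field_simps)
    finally have "v \<bullet> (z + t *\<^sub>R d - z) \<le> c * (dist (z + t *\<^sub>R d) z)\<^sup>2"
      using t by (intro le S) (auto simp: t0_def dist_norm)
    then have "t * (v \<bullet> d) \<le> t * (t * (c * (norm d)\<^sup>2))"
      using t by (simp add: dist_norm power_mult_distrib power2_eq_square algebra_simps)
    then show ?thesis using t by simp
  qed
  have "((\<lambda>t. t * (c * (norm d)\<^sup>2)) \<longlongrightarrow> 0 * (c * (norm d)\<^sup>2)) (at_right 0)"
    by (intro tendsto_intros)
  moreover have "eventually (\<lambda>t. v \<bullet> d \<le> t * (c * (norm d)\<^sup>2)) (at_right 0)"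
    using * t0 by (auto simp: eventually_at_right)
  ultimately show ?thesis
    using tendsto_lowerbound by fastforce
qed

lemma prox_normal_scale:
  assumes "v \<in> prox_normal z S" "t > 0"
  shows "t *\<^sub>R v \<in> prox_normal z S"
proof -
  obtain c \<delta> where z: "z \<in> S" and c: "c > 0" and \<delta>: "\<delta> > 0"
    and le: "\<And>y. y \<in> S \<Longrightarrow> dist y z < \<delta> \<Longrightarrow> v \<bullet> (y - z) \<le> c * (dist y z)\<^sup>2"
    using assms by (auto simp: prox_normal_def)
  have "(t *\<^sub>R v) \<bullet> (y - z) \<le> (t * c) * (dist y z)\<^sup>2" if "y \<in> S" "dist y z < \<delta>" for y
    using mult_left_mono[OF le[OF that], of t] assms(2) by (simp add: algebra_simps)
  then show ?thesis using z c \<delta> assms(2) unfolding prox_normal_def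
    by (smt (verit) mem_Collect_eq mult_pos_pos)
qed

text \<open>The mean minimises the sum of squared distances. This allows the mean to be frozen when
  a single copy is varied.\<close>

lemma sum_sqdist_mean_le:
  fixes x :: "'i::finite \<Rightarrow> 'a::real_inner"
  shows "(\<Sum>i\<in>UNIV. (norm (x i - (1 / real CARD('i)) *\<^sub>R (\<Sum>j\<in>UNIV. x j)))\<^sup>2) \<le> (\<Sum>i\<in>UNIV. (norm (x i - y))\<^sup>2)"
proof -
  define m where "m = (1 / real CARD('i)) *\<^sub>R (\<Sum>j\<in>UNIV. x j)"
  have s: "(\<Sum>i\<in>UNIV. (x i - m)) = 0"
    by (simp add: sum_subtractf m_def sum_constant_scaleR)
  have "(norm (x i - y))\<^sup>2 = (norm (x i - m))\<^sup>2 + 2 * ((x i - m) \<bullet> (m - y)) + (norm (m - y))\<^sup>2" for i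
    using dot_norm[of "x i - m" "m - y"] by simp
  then have "(\<Sum>i\<in>UNIV. (norm (x i - y))\<^sup>2) = (\<Sum>i\<in>UNIV. (norm (x i - m))\<^sup>2)
      + 2 * ((\<Sum>i\<in>UNIV. (x i - m)) \<bullet> (m - y)) + (\<Sum>i\<in>(UNIV::'i set). (norm (m - y))\<^sup>2)"
    by (simp add: sum.distrib inner_sum_left sum_distrib_left)
  moreover have "(\<Sum>i\<in>(UNIV::'i set). (norm (m - y))\<^sup>2) \<ge> 0" by (simp add: sum_nonneg)
  ultimately show ?thesis using s by (simp add: m_def)
qed

lemma compact_vec_components:
  fixes T :: "'i::finite \<Rightarrow> 'a::euclidean_space set"
  assumes "\<And>i. compact (T i)"
  shows "compact {z :: 'a^'i. \<forall>i. z $ i \<in> T i}"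
proof -
  have "closed {z :: 'a^'i. \<forall>i. z $ i \<in> T i}"
    by (intro closed_Collect_all) 
      (metis assms closed_vimage_vec_nth compact_imp_closed vimage_def)
  moreover have "bounded {z :: 'a^'i. \<forall>i. z $ i \<in> T i}"
  proof -
    have "\<forall>i. \<exists>B. \<forall>x\<in>T i. norm x \<le> B"
      using assms compact_imp_bounded bounded_iff by metis
    then obtain B where B: "\<And>i x. x \<in> T i \<Longrightarrow> norm x \<le> B i" by metis
    have "norm z \<le> (\<Sum>i\<in>UNIV. B i)" if "\<forall>i. z $ i \<in> T i" for z :: "'a^'i"
    proof -
      have "norm z \<le> (\<Sum>i\<in>UNIV. norm (z $ i))" unfolding norm_vec_def by (rule L2_set_le_sum) simp
      also have "\<dots> \<le> (\<Sum>i\<in>UNIV. B i)" using B that by (intro sum_mono) auto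
      finally show ?thesis .
    qed
    then show ?thesis unfolding bounded_iff by blast
  qed
  ultimately show ?thesis by (simp add: compact_eq_bounded_closed)
qed

section \<open>A sum rule by decoupling\<close>

text \<open>The penalised problems have solutions by compactness, and the first-order condition in
  each copy is a proximal normal to one epigraph. Closedness is asked only near the base points,
  because a locally Lipschitz function has an epigraph known to be closed only there.\<close>

lemma decoupled_sum_rule:
  fixes S :: "'i::finite \<Rightarrow> ('x::euclidean_space \<times> real) set" and \<alpha> \<tau> :: "'i \<Rightarrow> real"
  assumes r: "r > 0"
    and cl: "\<And>i. closed (S i \<inter> cball (xbar, \<tau> i) r)"
    and mem: "\<And>i. (xbar, \<tau> i) \<in> S i"
    and min: "\<And>x t. (\<And>i. (x, t i) \<in> S i \<inter> cball (xbar, \<tau> i) r) \<Longrightarrow>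
                (\<Sum>i\<in>UNIV. \<alpha> i * \<tau> i) \<le> (\<Sum>i\<in>UNIV. \<alpha> i * t i)"
  obtains zs V A s W where
    "\<And>k i. (V k i, - A k i) \<in> prox_normal (zs k i) (S i)"
    "\<And>i. (\<lambda>k. zs k i) \<longlonglongrightarrow> (xbar, \<tau> i)" "\<And>i. (\<lambda>k. V k i) \<longlonglongrightarrow> W i"
    "\<And>i. (\<lambda>k. A k i) \<longlonglongrightarrow> s * \<alpha> i" "(s::real) \<ge> 0" "(\<Sum>i\<in>UNIV. W i) = 0"
    "s = 0 \<Longrightarrow> \<exists>i. W i \<noteq> 0"
proof -
  define zb where "zb i = (xbar, \<tau> i)" for i
  define D where "D = {z :: ('x \<times> real)^'i. \<forall>i. z $ i \<in> S i \<inter> cball (zb i) r}"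
  define m where "m z = (1 / real CARD('i)) *\<^sub>R (\<Sum>j\<in>UNIV. fst (z $ j))" for z :: "('x \<times> real)^'i"
  define cost where "cost z = (\<Sum>i\<in>UNIV. \<alpha> i * snd (z $ i))" for z :: "('x \<times> real)^'i"
  \<comment> \<open>Deviations are measured from the mean because they sum to zero; this makes the
    gradients of the penalty cancel in \<open>sumV\<close>, whatever the size of
    \<open>k\<close>.\<close>
  define spread where "spread z = (\<Sum>i\<in>UNIV. (norm (fst (z $ i) - m z))\<^sup>2)" for z :: "('x \<times> real)^'i"
  \<comment> \<open>This term makes the base tuple the only possible limit of the minimisers;
    otherwise they could drift to another solution of the limit problem.\<close>
  define loc where "loc z = (\<Sum>i\<in>UNIV. (dist (z $ i) (zb i))\<^sup>2)" for z :: "('x \<times> real)^'i"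
  define F where "F k z = cost z + real k * spread z + loc z" for k z
  define z0 where "z0 = (\<chi> i. zb i)"
  have cD: "compact D" unfolding D_def
  proof (rule compact_vec_components)
    fix i
    have "S i \<inter> cball (zb i) r = S i \<inter> cball (xbar, \<tau> i) r \<inter> cball (xbar, \<tau> i) r" by (auto simp: zb_def)
    then show "compact (S i \<inter> cball (zb i) r)"
      by (metis cl closed_Int_compact compact_cball)
  qed
  have z0D: "z0 \<in> D" using mem r by (auto simp: z0_def D_def zb_def)
  have cont_cost: "continuous_on X cost" for X unfolding cost_def
    by (intro continuous_intros)
  have cont_spread: "continuous_on X spread" for X unfolding spread_def m_def
    by (intro continuous_intros)
  have cont_loc: "continuous_on X loc" for X unfolding loc_def
    by (intro continuous_intros)
  have "\<exists>z\<in>D. \<forall>y\<in>D. F k z \<le> F k y" for k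
    by (rule continuous_attains_inf[OF cD])
      (use z0D in \<open>auto simp: F_def intro!: continuous_intros cont_cost cont_spread cont_loc\<close>)
  then obtain zk where zkD: "\<And>k. zk k \<in> D" and zk_min: "\<And>k y. y \<in> D \<Longrightarrow> F k (zk k) \<le> F k y"
    by metis
  have m_z0: "m z0 = xbar"
    by (simp add: m_def z0_def zb_def sum_constant_scaleR)
  have F_z0: "F k z0 = cost z0" for k
    by (simp add: F_def spread_def loc_def m_z0) (simp add: z0_def zb_def)
  have spread_nn: "spread z \<ge> 0" and loc_nn: "loc z \<ge> 0" for z
    by (auto simp: spread_def loc_def intro!: sum_nonneg)
  obtain zi q where zi: "zi \<in> D" and q: "strict_mono q" and lim: "(zk \<circ> q) \<longlonglongrightarrow> zi"
    using cD zkD unfolding compact_def by metis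
  have contlim: "(\<lambda>k. g (zk (q k))) \<longlonglongrightarrow> g zi"
    if "continuous_on UNIV g" for g :: "('x \<times> real)^'i \<Rightarrow> real"
    using continuous_on_tendsto_compose[OF that lim] by (simp add: o_def)
  note lim_cost = contlim[OF cont_cost] and lim_spread = contlim[OF cont_spread]
    and lim_loc = contlim[OF cont_loc]
  have bnd: "cost (zk k) + real k * spread (zk k) + loc (zk k) \<le> cost z0" for k
    using zk_min[OF z0D, of k] unfolding F_z0 by (simp add: F_def)
  have bnd2: "cost (zk k) + loc (zk k) \<le> cost z0" for k
    using bnd[of k] spread_nn[of "zk k"] by (smt (verit) mult_nonneg_nonneg of_nat_0_le_iff)
  \<comment> \<open>The product \<open>q k * spread\<close> stays below a convergent cost gap, so
    the spread is O(1 / \<open>q k\<close>).\<close>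
  have "spread zi \<le> 0"
  proof -
    have "spread (zk (q k)) \<le> (cost z0 - cost (zk (q k))) * inverse (real (q k))" if k: "k > 0" for k
    proof -
      have "q k > 0" using seq_suble[OF q, of k] k by linarith
      moreover have "real (q k) * spread (zk (q k)) \<le> cost z0 - cost (zk (q k))"
        using bnd[of "q k"] loc_nn[of "zk (q k)"] by linarith
      ultimately show ?thesis by (simp add: field_simps)
    qed
    then have "eventually (\<lambda>k. spread (zk (q k)) \<le> (cost z0 - cost (zk (q k))) * inverse (real (q k))) sequentially"
      by (intro eventually_sequentiallyI[of 1]) auto
    moreover have "(\<lambda>k. inverse (real (q k))) \<longlonglongrightarrow> 0"
      using LIMSEQ_subseq_LIMSEQ[OF lim_inverse_n q] by (simp add: o_def)
    then have "(\<lambda>k. (cost z0 - cost (zk (q k))) * inverse (real (q k))) \<longlonglongrightarrow> (cost z0 - cost zi) * 0"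
      by (intro tendsto_intros lim_cost)
    ultimately show ?thesis
      using tendsto_le[OF sequentially_bot _ lim_spread, of "\<lambda>k. (cost z0 - cost (zk (q k))) * inverse (real (q k))"] by simp
  qed
  then have "spread zi = 0" using spread_nn[of zi] by simp
  then have eqm: "fst (zi $ i) = m zi" for i
    unfolding spread_def by (subst (asm) sum_nonneg_eq_0_iff) auto
  \<comment> \<open>In the limit all copies agree, so the limit tuple is a competitor in
    \<open>min\<close>. With the bound in the other direction, nothing is left for
    \<open>loc zi\<close>.\<close>
  have "cost z0 \<le> cost zi"
  proof -
    have "(m zi, snd (zi $ i)) \<in> S i \<inter> cball (xbar, \<tau> i) r" for i
      using zi eqm[of i] by (metis (no_types, lifting) D_def mem_Collect_eq prod.collapse zb_def)
    from min[OF this] show ?thesis by (simp add: cost_def z0_def zb_def)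
  qed
  moreover have "cost zi + loc zi \<le> cost z0"
    by (rule tendsto_upperbound[OF tendsto_add[OF lim_cost lim_loc]]) (use bnd2 in auto)
  ultimately have "loc zi = 0" using loc_nn[of zi] by linarith
  then have zi_eq: "zi $ i = zb i" for i
    unfolding loc_def by (subst (asm) sum_nonneg_eq_0_iff) auto
  have limc: "(\<lambda>k. zk (q k) $ i) \<longlonglongrightarrow> zb i" for i
    using tendsto_vec_nth[OF lim, of i] by (simp add: zi_eq o_def)
  \<comment> \<open>\<open>(V k i, - A k i)\<close> is minus the gradient of the objective in the
    i-th copy at the minimiser, with the mean treated as a constant.\<close>
  define V where "V k i = - ((2 * real k) *\<^sub>R (fst (zk k $ i) - m (zk k)) + 2 *\<^sub>R (fst (zk k $ i) - xbar))" for k i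
  define A where "A k i = \<alpha> i + 2 * (snd (zk k $ i) - \<tau> i)" for k i
  have pn: "(V k i, - A k i) \<in> prox_normal (zk k $ i) (S i)" if near: "dist (zk k $ i) (zb i) < r" for k i
  proof -
    \<comment> \<open>This is the share of copy \<open>j\<close> in the objective with the mean
      frozen at its value for \<open>zk k\<close>. Freezing is exact at \<open>zk k\<close> and only
      increases the objective elsewhere, so the i-th copy still minimises \<open>h i\<close> locally
      on \<open>S i\<close>.\<close>
    define h where "h j u = \<alpha> j * snd u + real k * (norm (fst u - m (zk k)))\<^sup>2 + (dist u (zb j))\<^sup>2" for j and u :: "'x \<times> real"
    have main: "(V k i, - A k i) \<bullet> (w - zk k $ i) \<le> (real k + 1) * (dist w (zk k $ i))\<^sup>2"
      if w: "w \<in> S i" "dist w (zk k $ i) < r - dist (zk k $ i) (zb i)" for w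
    proof -
      define z' where "z' = (\<chi> j. if j = i then w else zk k $ j)"
      have "dist w (zb i) \<le> dist w (zk k $ i) + dist (zk k $ i) (zb i)" by (rule dist_triangle)
      then have "w \<in> cball (zb i) r" using w by (simp add: dist_commute)
      then have "z' \<in> D" using w zkD[of k] by (auto simp: z'_def D_def)
      then have "F k (zk k) \<le> F k z'" by (rule zk_min)
      also have "F k z' \<le> (\<Sum>j\<in>UNIV. h j (z' $ j))"
      proof -
        have "spread z' \<le> (\<Sum>j\<in>UNIV. (norm (fst (z' $ j) - m (zk k)))\<^sup>2)"
          unfolding spread_def m_def by (rule sum_sqdist_mean_le)
        then have "real k * spread z' \<le> real k * (\<Sum>j\<in>UNIV. (norm (fst (z' $ j) - m (zk k)))\<^sup>2)"
          by (intro mult_left_mono) auto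
        then show ?thesis
          by (simp add: F_def h_def cost_def loc_def sum.distrib sum_distrib_left)
      qed
      also have "F k (zk k) = (\<Sum>j\<in>UNIV. h j (zk k $ j))"
        by (simp add: F_def h_def cost_def loc_def spread_def sum.distrib sum_distrib_left)
      also have "\<dots> = h i (zk k $ i) + (\<Sum>j\<in>UNIV - {i}. h j (zk k $ j))"
        by (intro sum.remove) auto
      also have "(\<Sum>j\<in>UNIV. h j (z' $ j)) = h i (z' $ i) + (\<Sum>j\<in>UNIV - {i}. h j (z' $ j))"
        by (intro sum.remove) auto
      also have "(\<Sum>j\<in>UNIV - {i}. h j (z' $ j)) = (\<Sum>j\<in>UNIV - {i}. h j (zk k $ j))"
        by (intro sum.cong) (auto simp: z'_def)
      also have "z' $ i = w" by (simp add: z'_def)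
      finally have le: "h i (zk k $ i) \<le> h i w" by simp
      obtain x t where xt: "zk k $ i = (x, t)" by fastforce
      obtain y u where yu: "w = (y, u)" by fastforce
      define d where "d = y - x"
      have y: "y = x + d" by (simp add: d_def)
      have 1: "(norm (x + d - m (zk k)))\<^sup>2 = (norm (x - m (zk k)))\<^sup>2 + 2 * ((x - m (zk k)) \<bullet> d) + (norm d)\<^sup>2"
        using dot_norm[of "x - m (zk k)" d] by (simp add: algebra_simps)
      have 2: "(norm (x + d - xbar))\<^sup>2 = (norm (x - xbar))\<^sup>2 + 2 * ((x - xbar) \<bullet> d) + (norm d)\<^sup>2"
        using dot_norm[of "x - xbar" d] by (simp add: algebra_simps)
      have 3: "(dist (x + d, u) (zb i))\<^sup>2 = (norm (x + d - xbar))\<^sup>2 + (u - \<tau> i)\<^sup>2"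
        "(dist (x, t) (zb i))\<^sup>2 = (norm (x - xbar))\<^sup>2 + (t - \<tau> i)\<^sup>2"
        "(dist (x + d, u) (x, t))\<^sup>2 = (norm d)\<^sup>2 + (u - t)\<^sup>2"
        by (simp_all add: zb_def y dist_norm norm_Pair)
      have 4: "(u - \<tau> i)\<^sup>2 - (t - \<tau> i)\<^sup>2 = 2 * (t - \<tau> i) * (u - t) + (u - t)\<^sup>2"
        by (simp add: power2_eq_square algebra_simps)
      \<comment> \<open>All terms are at most quadratic, so the expansion is exact and its
        second-order part gives the constant \<open>k + 1\<close>. That it grows with
        \<open>k\<close> does no harm: proximal normals allow a different constant at each
        point.\<close>
      have "- (2 * real k * ((x - m (zk k)) \<bullet> d) + 2 * ((x - xbar) \<bullet> d) + (\<alpha> i + 2 * (t - \<tau> i)) * (u - t))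
         \<le> real k * (norm d)\<^sup>2 + (norm d)\<^sup>2 + (u - t)\<^sup>2"
        using le 4 unfolding h_def xt yu 3 fst_conv snd_conv y 1 2
        by (simp add: algebra_simps)
      also have "\<dots> \<le> (real k + 1) * (dist w (zk k $ i))\<^sup>2"
        unfolding xt yu y 3 by (simp add: algebra_simps)
      finally show ?thesis
        unfolding V_def A_def xt yu using y
        by (simp add: inner_add_left inner_diff_left algebra_simps)
    qed
    have "zk k $ i \<in> S i" using zkD[of k] by (auto simp: D_def)
    moreover have "r - dist (zk k $ i) (zb i) > 0" using near by simp
    moreover have "real k + 1 > 0" by simp
    ultimately show ?thesis unfolding prox_normal_def using main by blast
  qed
  have sumV: "(\<Sum>i\<in>UNIV. V k i) = - 2 *\<^sub>R (\<Sum>i\<in>UNIV. fst (zk k $ i) - xbar)" for k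
  proof -
    have "(\<Sum>i\<in>UNIV. fst (zk k $ i) - m (zk k)) = 0"
      by (simp add: sum_subtractf m_def sum_constant_scaleR)
    then have "(\<Sum>i\<in>UNIV. (2 * real k) *\<^sub>R (fst (zk k $ i) - m (zk k))) = 0"
      by (metis (no_types) scaleR_sum_right scaleR_zero_right)
    moreover have "(\<Sum>i\<in>UNIV. V k i) = - (\<Sum>i\<in>UNIV. (2 * real k) *\<^sub>R (fst (zk k $ i) - m (zk k)))
        - (\<Sum>i\<in>UNIV. 2 *\<^sub>R (fst (zk k $ i) - xbar))"
      unfolding V_def by (simp add: sum.distrib sum_negf sum_subtractf)
    ultimately show ?thesis by (simp add: scaleR_sum_right sum_negf)
  qed
  define Vv where "Vv k = (\<chi> i. V (q k) i)" for k
  \<comment> \<open>With this scale both \<open>s\<close> and the scaled multipliers stay in unit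
    balls, and their norm is exactly \<open>1 - s\<close>. Hence if \<open>s\<close> tends to 0 the
    limit vector has norm 1, which is the last claim.\<close>
  define s where "s k = 1 / (1 + norm (Vv k))" for k
  have pos: "1 + norm (Vv k) > 0" for k by (simp add: add_pos_nonneg)
  have s01: "0 < s k" "s k \<le> 1" for k using pos[of k] by (auto simp: s_def)
  have nsV: "norm (s k *\<^sub>R Vv k) = 1 - s k" for k
    using pos[of k] by (simp add: s_def field_simps)
  have inB: "(s k, s k *\<^sub>R Vv k) \<in> cball 0 1 \<times> cball 0 1" for k
    using s01[of k] nsV[of k] by simp
  have "compact (cball (0::real) 1 \<times> cball (0::'x^'i) 1)" by (intro compact_Times compact_cball)
  then obtain sW p where p: "strict_mono p" and "((\<lambda>k. (s k, s k *\<^sub>R Vv k)) \<circ> p) \<longlonglongrightarrow> sW"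
    unfolding compact_def using inB by meson
  moreover obtain s' W where "sW = (s', W)" by fastforce
  ultimately have lim_p: "(\<lambda>k. (s (p k), s (p k) *\<^sub>R Vv (p k))) \<longlonglongrightarrow> (s', W)" by (simp add: o_def)
  have lim_s: "(\<lambda>k. s (p k)) \<longlonglongrightarrow> s'" using tendsto_fst[OF lim_p] by simp
  have lim_W: "(\<lambda>k. s (p k) *\<^sub>R Vv (p k)) \<longlonglongrightarrow> W" using tendsto_snd[OF lim_p] by simp
  have lim_zp: "(\<lambda>k. zk (q (p k)) $ i) \<longlonglongrightarrow> zb i" for i
    using LIMSEQ_subseq_LIMSEQ[OF limc p] by (simp add: o_def)
  \<comment> \<open>The first-order condition \<open>pn\<close> holds only for copies strictly
    inside the balls, so an initial segment of the sequence is dropped.\<close>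
  have "\<forall>\<^sub>F k in sequentially. \<forall>i. dist (zk (q (p k)) $ i) (zb i) < r"
    using tendstoD[OF lim_zp r] by (simp add: eventually_all_finite)
  then obtain N where N: "\<And>k i. k \<ge> N \<Longrightarrow> dist (zk (q (p k)) $ i) (zb i) < r"
    by (auto simp: eventually_sequentially)
  show thesis
  proof (rule that[of "\<lambda>k i. s (p (k + N)) *\<^sub>R V (q (p (k + N))) i" "\<lambda>k i. s (p (k + N)) * A (q (p (k + N))) i"
        "\<lambda>k i. zk (q (p (k + N))) $ i" "\<lambda>i. W $ i" s'])
    show "(s (p (k + N)) *\<^sub>R V (q (p (k + N))) i, - (s (p (k + N)) * A (q (p (k + N))) i))
        \<in> prox_normal (zk (q (p (k + N))) $ i) (S i)" for k i
      using prox_normal_scale[OF pn[OF N] s01(1), of "k + N"] by simp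
    show "(\<lambda>k. zk (q (p (k + N))) $ i) \<longlonglongrightarrow> (xbar, \<tau> i)" for i
      using LIMSEQ_ignore_initial_segment[OF lim_zp[of i], of N] by (simp add: zb_def)
    show "(\<lambda>k. s (p (k + N)) *\<^sub>R V (q (p (k + N))) i) \<longlonglongrightarrow> W $ i" for i
      using tendsto_vec_nth[OF LIMSEQ_ignore_initial_segment[OF lim_W, of N], of i] by (simp add: Vv_def)
    have "(\<lambda>k. A (q (p k)) i) \<longlonglongrightarrow> \<alpha> i + 2 * (snd (zb i) - \<tau> i)" for i
      unfolding A_def by (intro tendsto_intros lim_zp)
    then have "(\<lambda>k. s (p k) * A (q (p k)) i) \<longlonglongrightarrow> s' * \<alpha> i" for i
      using tendsto_mult[OF lim_s, of "\<lambda>k. A (q (p k)) i" "\<alpha> i"] by (simp add: zb_def)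
    then show "(\<lambda>k. s (p (k + N)) * A (q (p (k + N))) i) \<longlonglongrightarrow> s' * \<alpha> i" for i
      by (rule LIMSEQ_ignore_initial_segment)
    show "s' \<ge> 0" by (rule tendsto_lowerbound[OF lim_s]) (use s01(1)[THEN less_imp_le] in auto)
    have lim_sum: "(\<lambda>k. \<Sum>i\<in>UNIV. (s (p k) *\<^sub>R Vv (p k)) $ i) \<longlonglongrightarrow> (\<Sum>i\<in>UNIV. W $ i)"
      by (intro tendsto_intros lim_W)
    have "(\<Sum>i\<in>UNIV. (s (p k) *\<^sub>R Vv (p k)) $ i)
        = s (p k) *\<^sub>R (- 2 *\<^sub>R (\<Sum>i\<in>UNIV. fst (zk (q (p k)) $ i) - xbar))" for k
      by (simp add: Vv_def sumV flip: scaleR_sum_right)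
    moreover have "(\<lambda>k. s (p k) *\<^sub>R (- 2 *\<^sub>R (\<Sum>i\<in>UNIV. fst (zk (q (p k)) $ i) - xbar)))
        \<longlonglongrightarrow> s' *\<^sub>R (- 2 *\<^sub>R (\<Sum>i\<in>(UNIV::'i set). fst (zb i) - xbar))"
      by (intro tendsto_intros lim_zp lim_s)
    ultimately have "(\<lambda>k. \<Sum>i\<in>UNIV. (s (p k) *\<^sub>R Vv (p k)) $ i) \<longlonglongrightarrow> s' *\<^sub>R (- 2 *\<^sub>R (\<Sum>i\<in>(UNIV::'i set). fst (zb i) - xbar))"
      by (simp only:)
    with lim_sum have "(\<Sum>i\<in>UNIV. W $ i) = s' *\<^sub>R (- 2 *\<^sub>R (\<Sum>i\<in>(UNIV::'i set). fst (zb i) - xbar))"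
      by (rule LIMSEQ_unique)
    then show "(\<Sum>i\<in>UNIV. W $ i) = 0" by (simp add: zb_def)
    have "norm W = 1 - s'"
      using tendsto_norm[OF lim_W] tendsto_diff[OF tendsto_const lim_s, of 1]
      unfolding nsV by (rule LIMSEQ_unique)
    then show "s' = 0 \<Longrightarrow> \<exists>i. W $ i \<noteq> 0"
      by (metis norm_zero zero_index vec_eq_iff diff_zero zero_neq_one)
  qed
qed

section \<open>Proximal subgradients of distance functions\<close>

text \<open>A growth bound with slope \<open>M\<close> keeps the ray in direction
  \<open>(d, M)\<close> inside the epigraph, even from a point strictly above the graph.\<close>

lemma prox_normal_epi_direction:
  assumes v: "(v, - A) \<in> prox_normal (x, t) (epi \<psi>)" and e: "e > 0"
    and le: "\<And>\<tau>. 0 < \<tau> \<Longrightarrow> \<tau> < e \<Longrightarrow> \<psi> (x + \<tau> *\<^sub>R d) \<le> \<psi> x + ereal (\<tau> * M)"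
  shows "v \<bullet> d \<le> A * M"
proof -
  have xt: "\<psi> x \<le> ereal t" using v by (auto simp: prox_normal_def epi_def)
  have "(v, - A) \<bullet> (d, M) \<le> 0"
  proof (rule prox_normal_direction[OF v e])
    fix \<tau> :: real assume "0 < \<tau>" "\<tau> < e"
    from le[OF this] have "\<psi> (x + \<tau> *\<^sub>R d) \<le> ereal t + ereal (\<tau> * M)"
      using xt by (metis add_right_mono order_trans)
    then show "(x, t) + \<tau> *\<^sub>R (d, M) \<in> epi \<psi>" by (simp add: epi_def)
  qed
  then show ?thesis by simp
qed

lemma prox_normal_epi_nonneg:
  assumes "(v, - A) \<in> prox_normal (x, t) (epi \<psi>)"
  shows "A \<ge> 0"
  \<comment> \<open>The choice \<open>d = 0\<close>, \<open>M = 1\<close> is the upward vertical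
    direction.\<close>
  using prox_normal_epi_direction[OF assms zero_less_one, of 0 1]
  by (simp add: add_increasing2)

text \<open>Test with the direction \<open>v\<close> itself, along which the slope is at most
  \<open>L * norm v\<close>. In the limit this is why Lipschitz terms vanish when
  \<open>s = 0\<close>.\<close>

lemma prox_normal_epi_lipschitz_bound:
  fixes g :: "'a::real_inner \<Rightarrow> real"
  assumes v: "(v, - A) \<in> prox_normal (x, t) (epi (\<lambda>y. ereal (g y)))" and e: "e > 0" and L: "L \<ge> 0"
    and lip: "\<And>y. dist y x < e \<Longrightarrow> g y \<le> g x + L * dist y x"
  shows "norm v \<le> A * L"
proof (cases "v = 0")
  case True
  then show ?thesis using prox_normal_epi_nonneg[OF v] L by simp
next
  case False
  have "v \<bullet> v \<le> A * (L * norm v)"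
  proof (rule prox_normal_epi_direction[OF v])
    show "e / norm v > 0" using e False by simp
    fix \<tau> assume t: "0 < \<tau>" "\<tau> < e / norm v"
    then have "\<tau> * norm v < e" using False by (simp add: field_simps)
    then have "g (x + \<tau> *\<^sub>R v) \<le> g x + L * dist (x + \<tau> *\<^sub>R v) x"
      using t by (intro lip) (simp add: dist_norm)
    then show "ereal (g (x + \<tau> *\<^sub>R v)) \<le> ereal (g x) + ereal (\<tau> * (L * norm v))"
      using t by (simp add: dist_norm algebra_simps)
  qed
  then have "norm v * norm v \<le> (A * L) * norm v"
    by (simp add: dot_square_norm power2_eq_square algebra_simps)
  then show ?thesis using False by simp
qed

lemma infdist_proj_translate:
  fixes p :: "'a::real_normed_vector"
  assumes "infdist p T = dist p q" "q' \<in> T"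
  shows "infdist (q' + (p - q)) T \<le> infdist p T"
proof -
  have "dist (q' + (p - q)) q' = dist p q" by (simp add: dist_norm)
  then show ?thesis using infdist_le[OF assms(2), of "q' + (p - q)"] assms(1) by simp
qed

text \<open>Here \<open>g\<close> is a distance-like function and \<open>q\<close> a nearest point to \<open>p\<close>: moving along the
  translate \<open>T + (p - q)\<close> keeps \<open>g\<close> below \<open>g p\<close>, so the proximal inequality at \<open>(p, t)\<close>
  becomes one for \<open>T\<close> at \<open>q\<close>.\<close>

lemma prox_normal_epi_translate:
  fixes g :: "'a::real_inner \<Rightarrow> real"
  assumes v: "(v, - A) \<in> prox_normal (p, t) (epi (\<lambda>y. ereal (g y)))" and q: "q \<in> T"
    and le: "\<And>q'. q' \<in> T \<Longrightarrow> g (q' + (p - q)) \<le> g p"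
  shows "v \<in> prox_normal q T"
proof -
  obtain c \<delta> where pt: "g p \<le> t" and c: "c > 0" "\<delta> > 0"
    and *: "\<And>y. y \<in> epi (\<lambda>y. ereal (g y)) \<Longrightarrow> dist y (p, t) < \<delta> \<Longrightarrow> (v, - A) \<bullet> (y - (p, t)) \<le> c * (dist y (p, t))\<^sup>2"
    using v by (auto simp: prox_normal_def epi_def)
  have "v \<bullet> (y - q) \<le> c * (dist y q)\<^sup>2" if y: "y \<in> T" "dist y q < \<delta>" for y
  proof -
    have "dist (y + (p - q), t) (p, t) = dist y q" by (simp add: dist_Pair_Pair dist_norm)
    then show ?thesis
      using *[of "(y + (p - q), t)"] le[OF y(1)] pt y(2) by (simp add: epi_def)
  qed
  then show ?thesis using c q unfolding prox_normal_def by blast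
qed

text \<open>Stated for an abstract \<open>g\<close> so as to cover both the distance to a set and
  the distance within a fibre of \<open>K\<close>. The residual has length \<open>g (P k)\<close>,
  which is below the height of \<open>zs k\<close> and so tends to 0; the feet \<open>Q k\<close>
  then converge to \<open>p\<close> and carry the normals.\<close>

lemma epi_subgradient_limit_normal:
  fixes g :: "'a::euclidean_space \<Rightarrow> real"
  assumes proj: "\<And>p. \<exists>q\<in>T. dist p q = g p \<and> (\<forall>q'\<in>T. g (q' + (p - q)) \<le> g p)"
    and pn: "\<And>k. (V k, - A k) \<in> prox_normal (zs k) (epi (\<lambda>y. ereal (g y)))"
    and zs: "zs \<longlonglongrightarrow> (p, 0)" and V: "V \<longlonglongrightarrow> W" and p: "p \<in> T"
  shows "W \<in> basic_normal p T"
proof -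
  define P where "P k = fst (zs k)" for k
  have "\<forall>k. \<exists>q. q \<in> T \<and> dist (P k) q = g (P k) \<and> (\<forall>q'\<in>T. g (q' + (P k - q)) \<le> g (P k))"
    using proj by blast
  from choice[OF this] obtain Q where Q: "\<And>k. Q k \<in> T" "\<And>k. dist (P k) (Q k) = g (P k)"
    "\<And>k q'. q' \<in> T \<Longrightarrow> g (q' + (P k - Q k)) \<le> g (P k)"
    by blast
  have gt: "g (P k) \<le> snd (zs k)" for k
    using pn[of k] by (auto simp: prox_normal_def epi_def P_def)
  have "Q \<longlonglongrightarrow> p"
  proof -
    have "(\<lambda>k. dist (P k) (Q k)) \<longlonglongrightarrow> 0"
      by (rule tendsto_sandwich[OF _ _ tendsto_const, of _ _ _ "\<lambda>k. snd (zs k)"])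
        (use gt tendsto_snd[OF zs] in \<open>auto simp flip: Q(2)\<close>)
    then have "(\<lambda>k. P k - Q k) \<longlonglongrightarrow> 0" by (simp add: dist_norm tendsto_norm_zero_iff)
    moreover have "P \<longlonglongrightarrow> p" using tendsto_fst[OF zs] by (simp add: P_def[abs_def])
    ultimately have "(\<lambda>k. P k - (P k - Q k)) \<longlonglongrightarrow> p - 0" by (intro tendsto_diff)
    then show ?thesis by simp
  qed
  then show ?thesis
  proof (rule basic_normal_limit[OF p _ V])
    show "V k \<in> prox_normal (Q k) T" for k
    proof (rule prox_normal_epi_translate)
      show "(V k, - A k) \<in> prox_normal (P k, snd (zs k)) (epi (\<lambda>y. ereal (g y)))"
        using pn[of k] by (simp add: P_def)
    qed (use Q in auto)
  qed
qed

lemma infdist_proj_residual: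
  fixes T :: "'a::euclidean_space set"
  assumes "closed T" "T \<noteq> {}"
  shows "\<exists>q\<in>T. dist p q = infdist p T \<and> (\<forall>q'\<in>T. infdist (q' + (p - q)) T \<le> infdist p T)"
proof -
  obtain q where "q \<in> T" "infdist p T = dist p q" using infdist_attains_inf[OF assms] by blast
  then show ?thesis using infdist_proj_translate[of p T q] by auto
qed

lemma infdist_epi_bound:
  assumes "(v, - A) \<in> prox_normal z (epi (\<lambda>y. ereal (infdist y T)))"
  shows "norm v \<le> A"
proof -
  have "norm v \<le> A * 1"
    by (rule prox_normal_epi_lipschitz_bound[where e = 1 and x = "fst z" and t = "snd z"])
      (use assms infdist_triangle in auto)
  then show ?thesis by simp
qed

text \<open>At points of \<open>T\<close> this is the limit of normals together with the Lipschitz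
  bound. Off \<open>T\<close> the distance decreases at unit rate towards a nearest point, and a
  vector of norm at most 1 with that slope must be the unit residual.\<close>

lemma infdist_epi_limit_trunc_normal:
  fixes T :: "'a::euclidean_space set"
  assumes T: "closed T" "T \<noteq> {}"
    and pn: "\<And>k. (V k, - A k) \<in> prox_normal (zs k) (epi (\<lambda>y. ereal (infdist y T)))"
    and zs: "zs \<longlonglongrightarrow> (x, infdist x T)" and V: "V \<longlonglongrightarrow> W" and A: "A \<longlonglongrightarrow> s" and s: "s > 0"
  shows "(1 / s) *\<^sub>R W \<in> trunc_normal x T"
proof -
  have nW: "norm W \<le> s"
    by (rule LIMSEQ_le[OF tendsto_norm[OF V] A]) (use infdist_epi_bound[OF pn] in auto)
  then have nw: "norm ((1 / s) *\<^sub>R W) \<le> 1" using s by simp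
  show ?thesis
  proof (cases "x \<in> T")
    case True
    then have "W \<in> basic_normal x T"
      using epi_subgradient_limit_normal[OF infdist_proj_residual[OF T] pn _ V True] zs by simp
    then have "(1 / s) *\<^sub>R W \<in> basic_normal x T" using s by (intro basic_normal_scale) auto
    then show ?thesis using True nw by (simp add: trunc_normal_def)
  next
    case False
    define d where "d = infdist x T"
    have d: "d > 0" using infdist_pos_not_in_closed[OF T False] by (simp add: d_def)
    define P where "P k = fst (zs k)" for k
    have P: "P \<longlonglongrightarrow> x" using tendsto_fst[OF zs] by (simp add: P_def[abs_def])
    have "\<forall>k. \<exists>q\<in>T. infdist (P k) T = dist (P k) q" using infdist_attains_inf[OF T] by metis
    then obtain Q where Q: "\<And>k. Q k \<in> T" "\<And>k. infdist (P k) T = dist (P k) (Q k)" by metis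
    have VQ: "V k \<bullet> (Q k - P k) \<le> A k * (- infdist (P k) T)" for k
    proof (rule prox_normal_epi_direction[where e = 1 and x = "P k" and t = "snd (zs k)"])
      show "(V k, - A k) \<in> prox_normal (P k, snd (zs k)) (epi (\<lambda>y. ereal (infdist y T)))"
        using pn by (simp add: P_def)
      fix \<tau> :: real assume \<tau>: "0 < \<tau>" "\<tau> < 1"
      have "infdist (P k + \<tau> *\<^sub>R (Q k - P k)) T \<le> dist (P k + \<tau> *\<^sub>R (Q k - P k)) (Q k)"
        by (rule infdist_le[OF Q(1)])
      also have "P k + \<tau> *\<^sub>R (Q k - P k) - Q k = (1 - \<tau>) *\<^sub>R (P k - Q k)" by (simp add: algebra_simps)
      then have "dist (P k + \<tau> *\<^sub>R (Q k - P k)) (Q k) = (1 - \<tau>) * dist (P k) (Q k)"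
        using \<tau> by (simp add: dist_norm)
      finally show "ereal (infdist (P k + \<tau> *\<^sub>R (Q k - P k)) T)
          \<le> ereal (infdist (P k) T) + ereal (\<tau> * - infdist (P k) T)"
        using Q(2)[of k] by (simp add: algebra_simps)
    qed simp
    have dP: "(\<lambda>k. infdist (P k) T) \<longlonglongrightarrow> d" unfolding d_def by (intro tendsto_intros P)
    have "bounded (range Q)"
    proof -
      obtain B1 where B1: "\<And>k. norm (P k) \<le> B1"
        using convergent_imp_bounded[OF P] by (auto simp: bounded_iff)
      obtain B2 where B2: "\<And>k. norm (infdist (P k) T) \<le> B2"
        using convergent_imp_bounded[OF dP] by (auto simp: bounded_iff)
      have "norm (Q k) \<le> B1 + B2" for k
        using B1[of k] B2[of k] Q(2)[of k] norm_triangle_ineq4[of "P k" "P k - Q k"] by (simp add: dist_norm)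
      then show ?thesis by (auto simp: bounded_iff)
    qed
    \<comment> \<open>Projections need not be unique, so the feet converge only along a subsequence;
      any cluster point is a nearest point of \<open>x\<close>.\<close>
    then obtain z r where r: "strict_mono r" and "(Q \<circ> r) \<longlonglongrightarrow> z"
      using bounded_imp_convergent_subsequence by blast
    then have z: "(\<lambda>k. Q (r k)) \<longlonglongrightarrow> z" by (simp add: o_def)
    have Pr: "(\<lambda>k. P (r k)) \<longlonglongrightarrow> x" and Vr: "(\<lambda>k. V (r k)) \<longlonglongrightarrow> W" and Ar: "(\<lambda>k. A (r k)) \<longlonglongrightarrow> s"
      using P V A r by (simp_all add: LIMSEQ_subseq_LIMSEQ[unfolded o_def])
    have dPr: "(\<lambda>k. infdist (P (r k)) T) \<longlonglongrightarrow> d" unfolding d_def by (intro tendsto_intros Pr)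
    have zT: "z \<in> T" using closed_sequentially[OF T(1) _ z] Q(1) by blast
    have dz: "dist x z = d"
    proof (rule LIMSEQ_unique)
      show "(\<lambda>k. dist (P (r k)) (Q (r k))) \<longlonglongrightarrow> dist x z" by (intro tendsto_intros Pr z)
      show "(\<lambda>k. dist (P (r k)) (Q (r k))) \<longlonglongrightarrow> d" using dPr by (simp only: Q(2))
    qed
    have "W \<bullet> (z - x) \<le> s * (- d)"
    proof (rule LIMSEQ_le)
      show "(\<lambda>k. V (r k) \<bullet> (Q (r k) - P (r k))) \<longlonglongrightarrow> W \<bullet> (z - x)" by (intro tendsto_intros Vr Pr z)
      show "(\<lambda>k. A (r k) * (- infdist (P (r k)) T)) \<longlonglongrightarrow> s * (- d)" by (intro tendsto_intros Ar dPr)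
    qed (use VQ in blast)
    define u where "u = (1 / d) *\<^sub>R (x - z)"
    define w where "w = (1 / s) *\<^sub>R W"
    have "norm u = 1" using dz d by (simp add: u_def dist_norm)
    have "w \<bullet> u \<ge> 1"
      using \<open>W \<bullet> (z - x) \<le> s * (- d)\<close> s d by (simp add: w_def u_def field_simps inner_diff_right)
    \<comment> \<open>Equality case of Cauchy-Schwarz: norms at most 1 and inner product at least 1
      force \<open>w = u\<close>.\<close>
    have "(norm (w - u))\<^sup>2 = (norm w)\<^sup>2 - 2 * (w \<bullet> u) + (norm u)\<^sup>2"
      by (simp add: power2_norm_eq_inner inner_diff_left inner_diff_right inner_commute)
    also have "\<dots> \<le> 0"
      using nw power_mono[of "norm w" 1 2] \<open>norm u = 1\<close> \<open>w \<bullet> u \<ge> 1\<close> by (simp add: w_def)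
    finally have "w = u" by simp
    moreover have "z \<in> proj_set x T" using zT dz by (simp add: proj_set_def d_def)
    ultimately show ?thesis using False by (auto simp: trunc_normal_def w_def u_def d_def)
  qed
qed

section \<open>Subdifferentials, exact penalisation and error bounds\<close>

lemma basic_subdiff_limit:
  assumes \<psi>: "\<psi> x = ereal \<tau>"
    and pn: "\<And>k. (V k, - A k) \<in> prox_normal (zs k) (epi \<psi>)"
    and zs: "zs \<longlonglongrightarrow> (x, \<tau>)" and V: "V \<longlonglongrightarrow> W" and A: "A \<longlonglongrightarrow> s" and s: "s > 0"
  shows "(1 / s) *\<^sub>R W \<in> basic_subdiff \<psi> x"
proof -
  have "(x, \<tau>) \<in> epi \<psi>" using \<psi> by (simp add: epi_def)
  moreover have "(\<lambda>k. (V k, - A k)) \<longlonglongrightarrow> (W, - s)" by (intro tendsto_intros V A)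
  ultimately have "(W, - s) \<in> basic_normal (x, \<tau>) (epi \<psi>)"
    by (rule basic_normal_limit[OF _ zs _ pn])
  then have "(1 / s) *\<^sub>R (W, - s) \<in> basic_normal (x, \<tau>) (epi \<psi>)"
    using s by (intro basic_normal_scale) auto
  then show ?thesis using s \<psi> by (simp add: basic_subdiff_def)
qed

lemma singular_subdiff_limit:
  assumes \<psi>: "\<psi> x = ereal \<tau>"
    and pn: "\<And>k. (V k, - A k) \<in> prox_normal (zs k) (epi \<psi>)"
    and zs: "zs \<longlonglongrightarrow> (x, \<tau>)" and V: "V \<longlonglongrightarrow> W" and A: "A \<longlonglongrightarrow> 0"
  shows "W \<in> singular_subdiff \<psi> x"
proof -
  have "(x, \<tau>) \<in> epi \<psi>" using \<psi> by (simp add: epi_def)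
  moreover have "(\<lambda>k. (V k, - A k)) \<longlonglongrightarrow> (W, - 0)" by (intro tendsto_intros V A)
  ultimately have "(W, - 0) \<in> basic_normal (x, \<tau>) (epi \<psi>)"
    by (rule basic_normal_limit[OF _ zs _ pn])
  then show ?thesis using \<psi> by (simp add: singular_subdiff_def)
qed

lemma closed_epi_continuous:
  assumes "continuous_on UNIV g"
  shows "closed (epi (\<lambda>p. ereal (g p)))"
proof -
  have "closed {z. g (fst z) \<le> snd z}"
    by (intro closed_Collect_le continuous_intros continuous_on_compose2[OF assms]) auto
  moreover have "epi (\<lambda>p. ereal (g p)) = {z. g (fst z) \<le> snd z}" by (auto simp: epi_def)
  ultimately show ?thesis by simp
qed

section \<open>Exact penalisation and the error bound\<close>

lemma infdist_approx:
  assumes "T \<noteq> {}" "e > 0"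
  shows "\<exists>q\<in>T. dist p q < infdist p T + e"
  using cInf_lessD[of "dist p ` T" "infdist p T + e"] assms by (auto simp: infdist_notempty)

text \<open>Compare \<open>p\<close> with an almost nearest point \<open>q\<close> of
  \<open>M\<close>: going there costs at most \<open>L\<close> times the distance. Almost nearest
  points are used since \<open>M\<close> carries no closedness.\<close>

lemma exact_penalty:
  fixes \<phi> :: "'a::metric_space \<Rightarrow> real"
  assumes lip: "lipschitz_on L (ball p0 r) \<phi>" and p0: "p0 \<in> M"
    and min: "\<And>q. q \<in> M \<Longrightarrow> q \<in> ball p0 r \<Longrightarrow> \<phi> p0 \<le> \<phi> q"
    and p: "dist p p0 < r / 4"
  shows "\<phi> p0 \<le> \<phi> p + L * infdist p M"
proof (rule field_le_epsilon)
  fix e :: real assume e: "e > 0"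
  have r: "r > 0" using p zero_le_dist[of p p0] by linarith
  have L: "L \<ge> 0" using lip by (rule lipschitz_on_nonneg)
  \<comment> \<open>The first bound gives \<open>L * e' \<le> e\<close>, with \<open>L + 1\<close>
    guarding against \<open>L = 0\<close>; the second leaves \<open>q\<close> within 3r/4 of
    \<open>p0\<close>.\<close>
  define e' where "e' = min (e / (L + 1)) (r / 4)"
  have e': "e' > 0" using e r L by (simp add: e'_def)
  obtain q where q: "q \<in> M" "dist p q < infdist p M + e'"
    using infdist_approx[OF _ e', of M p] p0 by blast
  have "dist p q < r / 2"
  proof -
    have "e' \<le> r / 4" unfolding e'_def by (rule min.cobounded2)
    then show ?thesis using q(2) infdist_le[OF p0, of p] p by linarith
  qed
  then have "q \<in> ball p0 r" using p r dist_triangle2[of p0 q p] by (simp add: dist_commute)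
  then have "\<phi> p0 \<le> \<phi> q" using min q by blast
  also have "\<dots> \<le> \<phi> p + L * dist p q"
    using lipschitz_onD[OF lip, of p q] \<open>q \<in> ball p0 r\<close> p r by (simp add: dist_real_def dist_commute)
  also have "L * dist p q \<le> L * (infdist p M + e')" using q L by (intro mult_left_mono) auto
  also have "L * e' \<le> (L + 1) * (e / (L + 1))"
    using L e r by (intro mult_mono) (auto simp: e'_def)
  then have "L * e' \<le> e" using L by simp
  then have "L * (infdist p M + e') \<le> L * infdist p M + e" by (simp add: distrib_left)
  finally show "\<phi> p0 \<le> \<phi> p + L * infdist p M + e" by simp
qed

text \<open>Minimise h + dist(., T) + gamma |. - xh|. Outside \<open>E\<close> the sum rule would
  write 0 as a + b plus a vector of norm at most gamma, against the hypothesis; so the minimiser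
  lies in \<open>E\<close>, and comparing its value with that at \<open>xh\<close> gives the
  estimate.\<close>

lemma error_bound_from_subdifferential:
  fixes T :: "'b::euclidean_space set" and h :: "'b \<Rightarrow> ereal"
  assumes T: "closed T" "T \<noteq> {}" and h: "closed (epi h)" "\<And>y. h y \<ge> 0" and \<gamma>: "\<gamma> > 0"
    and E: "\<And>x. x \<notin> E \<Longrightarrow> {a + b | a b. a \<in> basic_subdiff h x \<and> b \<in> trunc_normal x T} \<inter> cball 0 \<gamma> = {}"
    and t: "h xh \<le> ereal t"
  shows "\<exists>x\<in>E. \<gamma> * dist x xh \<le> t + infdist xh T"
proof -
  \<comment> \<open>Replacing the value of \<open>h\<close> by the height \<open>snd z\<close> makes
    the objective finite and continuous on the closed set \<open>epi h\<close>. All three terms are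
    nonnegative there, so sublevel sets are bounded.\<close>
  define F where "F z = snd z + infdist (fst z) T + \<gamma> * dist (fst z) xh" for z :: "'b \<times> real"
  define M where "M = t + infdist xh T"
  define D where "D = epi h \<inter> {z. F z \<le> M}"
  have contF: "continuous_on UNIV F" unfolding F_def by (intro continuous_intros)
  have nn: "snd z \<ge> 0" if "z \<in> epi h" for z
    using that h(2)[of "fst z"] by (auto simp: epi_def) (metis ereal_less_eq(5) order_trans)
  have "closed D" unfolding D_def
    by (intro closed_Int h closed_Collect_le contF continuous_intros)
  moreover have "bounded D"
  proof -
    have "D \<subseteq> cball xh (M / \<gamma>) \<times> cball 0 M"
    proof
      fix z assume z: "z \<in> D"
      then have "snd z \<ge> 0" using nn by (auto simp: D_def)
      moreover have "F z \<le> M" using z by (auto simp: D_def)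
      moreover have "\<gamma> * dist (fst z) xh \<ge> 0" using \<gamma> by simp
      ultimately have "\<gamma> * dist (fst z) xh \<le> M" "snd z \<le> M" "snd z \<ge> 0"
        using infdist_nonneg[of "fst z" T] by (auto simp: F_def)
      then show "z \<in> cball xh (M / \<gamma>) \<times> cball 0 M"
        using \<gamma> by (cases z) (auto simp: dist_commute field_simps)
    qed
    then show ?thesis by (rule bounded_subset[rotated]) (intro bounded_Times bounded_cball)
  qed
  ultimately have "compact D" by (simp add: compact_eq_bounded_closed)
  moreover have xhD: "(xh, t) \<in> D" using t by (simp add: D_def epi_def F_def M_def)
  ultimately obtain z where z: "z \<in> D" and zmin: "\<And>y. y \<in> D \<Longrightarrow> F z \<le> F y"
    using continuous_attains_inf[of D F] contF continuous_on_subset by blast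
  obtain x t1 where zx: "z = (x, t1)" by fastforce
  have glob: "F z \<le> F y" if "y \<in> epi h" for y
  proof (cases "F y \<le> M")
    case True
    then show ?thesis using zmin that by (simp add: D_def)
  next
    case False
    then show ?thesis using z by (simp add: D_def)
  qed
  have hx1: "h x \<le> ereal t1" using z by (auto simp: D_def epi_def zx)
  then obtain t0 where t0: "h x = ereal t0" using h(2)[of x] by (cases "h x") auto
  have "(x, t0) \<in> epi h" using t0 by (simp add: epi_def)
  \<comment> \<open>The minimiser sits on the graph of \<open>h\<close>, where subgradients are
    defined.\<close>
  from glob[OF this] have "t1 = t0" using hx1 t0 by (simp add: F_def zx)
  have "x \<in> E"
  proof (rule ccontr)
    assume "x \<notin> E"
    define S :: "3 \<Rightarrow> ('b \<times> real) set" where "S i = (if i = 1 then epi h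
        else if i = 2 then epi (\<lambda>y. ereal (infdist y T)) else epi (\<lambda>y. ereal (\<gamma> * dist y xh)))" for i
    define \<tau> :: "3 \<Rightarrow> real" where "\<tau> i = (if i = 1 then t0 else if i = 2 then infdist x T else \<gamma> * dist x xh)" for i
    have S: "S 1 = epi h" "S 2 = epi (\<lambda>y. ereal (infdist y T))" "S 3 = epi (\<lambda>y. ereal (\<gamma> * dist y xh))"
      and \<tau>: "\<tau> 1 = t0" "\<tau> 2 = infdist x T" "\<tau> 3 = \<gamma> * dist x xh"
      by (simp_all add: S_def \<tau>_def)
    have clS: "closed (S i)" for i
      unfolding S_def by (auto intro!: h closed_epi_continuous continuous_intros)
    obtain zs V A s W where pn: "\<And>k i. (V k i, - A k i) \<in> prox_normal (zs k i) (S i)"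
      and zs: "\<And>i. (\<lambda>k. zs k i) \<longlonglongrightarrow> (x, \<tau> i)" and V: "\<And>i. (\<lambda>k. V k i) \<longlonglongrightarrow> W i"
      and A: "\<And>i. (\<lambda>k. A k i) \<longlonglongrightarrow> s" and s: "(s::real) \<ge> 0" and sumW: "(\<Sum>i\<in>UNIV. W i) = 0"
      and s0: "s = 0 \<Longrightarrow> \<exists>i. W i \<noteq> 0"
    proof (rule decoupled_sum_rule[of 1 S x \<tau> "\<lambda>_. 1"])
      show "closed (S i \<inter> cball (x, \<tau> i) 1)" for i using clS by (intro closed_Int closed_cball)
      show "(x, \<tau> i) \<in> S i" for i by (auto simp: S_def \<tau>_def epi_def t0)
      fix y and u :: "3 \<Rightarrow> real" assume u: "\<And>i. (y, u i) \<in> S i \<inter> cball (x, \<tau> i) 1"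
      have "F z \<le> F (y, u 1)" using u[of 1] by (intro glob) (simp add: S)
      moreover have "infdist y T \<le> u 2" "\<gamma> * dist y xh \<le> u 3" using u[of 2] u[of 3] by (auto simp: S epi_def)
      ultimately show "(\<Sum>i\<in>UNIV. 1 * \<tau> i) \<le> (\<Sum>i\<in>UNIV. 1 * u i)"
        by (simp add: sum_3 \<tau> F_def zx \<open>t1 = t0\<close>)
    qed (simp_all, blast)
    have "norm (V k 2) \<le> A k 2" for k using infdist_epi_bound[OF pn[of k 2, unfolded S]] .
    then have W2: "norm (W 2) \<le> s" by (intro LIMSEQ_le[OF tendsto_norm[OF V[of 2]] A[of 2]]) auto
    have "norm (V k 3) \<le> A k 3 * \<gamma>" for k
    proof (rule prox_normal_epi_lipschitz_bound[where e = 1 and x = "fst (zs k 3)" and t = "snd (zs k 3)"])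
      show "(V k 3, - A k 3) \<in> prox_normal (fst (zs k 3), snd (zs k 3)) (epi (\<lambda>y. ereal (\<gamma> * dist y xh)))"
        using pn[of k 3] by (simp add: S)
      fix y
      have "\<gamma> * dist y xh \<le> \<gamma> * (dist (fst (zs k 3)) xh + dist y (fst (zs k 3)))"
        using \<gamma> dist_triangle[of y xh "fst (zs k 3)"] by (intro mult_left_mono) auto
      then show "\<gamma> * dist y xh \<le> \<gamma> * dist (fst (zs k 3)) xh + \<gamma> * dist y (fst (zs k 3))"
        by (simp add: algebra_simps)
    qed (use \<gamma> in auto)
    then have W3: "norm (W 3) \<le> s * \<gamma>"
      by (intro LIMSEQ_le[OF tendsto_norm[OF V[of 3]] tendsto_mult_right[OF A[of 3]]]) auto
    have sum3: "W 1 + W 2 + W 3 = 0" using sumW by (simp add: sum_3)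
    \<comment> \<open>Two of the three terms are Lipschitz, so for \<open>s = 0\<close> their
      vectors vanish and the zero sum removes the third.\<close>
    have "s \<noteq> 0"
    proof
      assume "s = 0"
      then have "W 2 = 0" "W 3 = 0" using W2 W3 by auto
      then have "\<forall>i. W i = 0" using sum3 by (simp add: forall_3)
      then show False using s0 \<open>s = 0\<close> by blast
    qed
    then have s: "s > 0" using s by simp
    have a: "(1 / s) *\<^sub>R W 1 \<in> basic_subdiff h x"
      by (rule basic_subdiff_limit[OF t0 pn[of _ 1, unfolded S] zs[of 1, unfolded \<tau>] V A s])
    have b: "(1 / s) *\<^sub>R W 2 \<in> trunc_normal x T"
      by (rule infdist_epi_limit_trunc_normal[OF T pn[of _ 2, unfolded S] zs[of 2, unfolded \<tau>] V A s])
    have "(1 / s) *\<^sub>R W 1 + (1 / s) *\<^sub>R W 2 = - ((1 / s) *\<^sub>R W 3)"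
      using sum3 by (metis add_eq_0_iff2 scaleR_minus_right scaleR_right_distrib)
    moreover have "norm ((1 / s) *\<^sub>R W 3) \<le> \<gamma>" using W3 s by (simp add: field_simps)
    ultimately have "(1 / s) *\<^sub>R W 1 + (1 / s) *\<^sub>R W 2 \<in> cball 0 \<gamma>" by simp
    with a b E[OF \<open>x \<notin> E\<close>] show False by blast
  qed
  moreover have "\<gamma> * dist x xh \<le> t + infdist xh T"
  proof -
    have "F z \<le> M" using z by (simp add: D_def)
    moreover have "t1 \<ge> 0" using nn[of z] z by (simp add: D_def zx)
    ultimately show ?thesis using infdist_nonneg[of x T] by (simp add: F_def M_def zx)
  qed
  ultimately show ?thesis by blast
qed

section \<open>Lower semicontinuity of the gap function and of the fibre distance\<close>

text \<open>If \<open>e\<close> is nearest to \<open>v - c\<close> in \<open>C\<close>, then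
  \<open>c + e\<close> lies in \<open>C\<close> at the same distance from \<open>v\<close>. So the
  set V - C in \<open>C_usc\<close> costs nothing: subtracting elements of the cone never shortens
  the distance to it.\<close>

lemma infdist_minus_cone_ge:
  fixes C :: "'c::euclidean_space set"
  assumes "closed C" "convex C" "cone C" "C \<noteq> {}" and c: "c \<in> C"
  shows "infdist v C \<le> infdist (v - c) C"
proof -
  obtain e where e: "e \<in> C" "infdist (v - c) C = dist (v - c) e"
    using infdist_attains_inf assms by metis
  have "c + e \<in> C" using assms c e convex_cone by blast
  from infdist_le[OF this, of v] show ?thesis using e(2) by (simp add: dist_norm algebra_simps)
qed

lemma gap_nu_le_iff:
  "gap_nu f C K (\<xi>, x) \<le> ereal t \<longleftrightarrow> (\<forall>z\<in>K \<xi>. infdist (f \<xi> x z) C \<le> t)"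
  by (simp add: gap_nu_def SUP_le_iff)

lemma gap_nu_nonneg:
  assumes "K \<xi> \<noteq> {}"
  shows "gap_nu f C K (\<xi>, x) \<ge> 0"
proof -
  obtain z where z: "z \<in> K \<xi>" using assms by blast
  have "(0::ereal) \<le> ereal (infdist (f \<xi> x z) C)" by (simp add: infdist_nonneg)
  also have "\<dots> \<le> gap_nu f C K (\<xi>, x)" unfolding gap_nu_def prod.case by (rule SUP_upper[OF z])
  finally show ?thesis .
qed

text \<open>A point z of K(xi) witnessing nu > t persists: \<open>C_usc\<close> keeps the distance
  large near (xi, x, z), and lower semicontinuity of \<open>K\<close> supplies nearby points of
  K(xi').\<close>

lemma closed_epi_gap_nu:
  fixes f :: "'a::euclidean_space \<Rightarrow> 'b::euclidean_space \<Rightarrow> 'b \<Rightarrow> 'c::euclidean_space"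
  assumes C: "closed C" "convex C" "cone C" "C \<noteq> {}"
    and lsc: "lsc_map K" and usc: "C_usc C (\<lambda>(\<xi>, x, z). f \<xi> x z)"
  shows "closed (epi (gap_nu f C K))"
proof -
  have "\<exists>U. open U \<and> w \<in> U \<and> U \<subseteq> - epi (gap_nu f C K)" if w: "w \<in> - epi (gap_nu f C K)" for w
  proof -
    obtain \<xi> x t where wx: "w = ((\<xi>, x), t)" by (metis prod.collapse)
    obtain z where z: "z \<in> K \<xi>" "t < infdist (f \<xi> x z) C"
      using w by (auto simp: wx epi_def gap_nu_le_iff not_le)
    \<comment> \<open>The room between \<open>t\<close> and \<open>t'\<close> makes the heights
      below \<open>t'\<close> a neighbourhood of \<open>t\<close>.\<close>
    then obtain t' where t': "t < t'" "t' < infdist (f \<xi> x z) C" using dense by blast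
    have "open {v. t' < infdist v C}" by (intro open_Collect_less continuous_intros)
    then obtain U where U: "open U" "(\<xi>, x, z) \<in> U"
      and fU: "\<And>u. u \<in> U \<Longrightarrow> (case u of (\<xi>, x, z) \<Rightarrow> f \<xi> x z) \<in> {v - c | v c. v \<in> {v. t' < infdist v C} \<and> c \<in> C}"
      using usc t' unfolding C_usc_def by (smt (verit, del_insts) case_prod_conv mem_Collect_eq)
    have fU': "t' < infdist (f \<xi>' x' z') C" if in_U: "(\<xi>', x', z') \<in> U" for \<xi>' x' z'
    proof -
      obtain v c where "f \<xi>' x' z' = v - c" "t' < infdist v C" "c \<in> C" using fU[OF in_U] by auto
      then show ?thesis using infdist_minus_cone_ge[OF C, of c v] by simp
    qed
    obtain A B0 where AB0: "open A" "open B0" "\<xi> \<in> A" "(x, z) \<in> B0" "A \<times> B0 \<subseteq> U"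
      using open_prod_elim[OF U] by (metis mem_Sigma_iff)
    obtain B D where BD: "open B" "open D" "x \<in> B" "z \<in> D" "B \<times> D \<subseteq> B0"
      using open_prod_elim[OF AB0(2,4)] by (metis mem_Sigma_iff)
    obtain A' where A': "open A'" "\<xi> \<in> A'" "\<And>\<xi>'. \<xi>' \<in> A' \<Longrightarrow> K \<xi>' \<inter> D \<noteq> {}"
      using lsc BD z(1) unfolding lsc_map_def by (metis IntI empty_iff)
    have "((A \<inter> A') \<times> B) \<times> {..<t'} \<subseteq> - epi (gap_nu f C K)"
    proof clarify
      fix \<xi>' x' s assume *: "\<xi>' \<in> A" "\<xi>' \<in> A'" "x' \<in> B" "s < t'" "((\<xi>', x'), s) \<in> epi (gap_nu f C K)"
      obtain z' where z': "z' \<in> K \<xi>'" "z' \<in> D" using A'(3)[OF *(2)] by blast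
      then have "t' < infdist (f \<xi>' x' z') C" using * AB0 BD by (intro fU') auto
      moreover have "infdist (f \<xi>' x' z') C \<le> s"
        using *(5) z' by (auto simp: epi_def gap_nu_le_iff)
      ultimately show False using *(4) by simp
    qed
    moreover have "open (((A \<inter> A') \<times> B) \<times> {..<t'})" using AB0 A' BD by (intro open_Times open_Int) auto
    moreover have "w \<in> ((A \<inter> A') \<times> B) \<times> {..<t'}" using AB0 A' BD t' by (simp add: wx)
    ultimately show ?thesis by blast
  qed
  then show ?thesis unfolding closed_def by (subst open_subopen) blast
qed

text \<open>Nearest points in the fibres stay bounded, and a cluster point lies over the limit
  parameter because the graph is closed.\<close>

lemma closed_epi_infdist_graph:
  fixes K :: "'a::euclidean_space \<Rightarrow> 'b::euclidean_space set"
  assumes cl: "closed (graph K)" and ne: "\<And>\<xi>. K \<xi> \<noteq> {}" and clK: "\<And>\<xi>. closed (K \<xi>)"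
  shows "closed (epi (\<lambda>p. ereal (infdist (snd p) (K (fst p)))))"
  unfolding closed_sequential_limits
proof (intro allI impI, elim conjE)
  fix zs w assume mem: "\<forall>n. zs n \<in> epi (\<lambda>p. ereal (infdist (snd p) (K (fst p))))" and lim: "zs \<longlonglongrightarrow> w"
  define p q t where "p n = fst (fst (zs n))" and "q n = snd (fst (zs n))" and "t n = snd (zs n)" for n
  have p: "p \<longlonglongrightarrow> fst (fst w)" and q: "q \<longlonglongrightarrow> snd (fst w)" and t: "t \<longlonglongrightarrow> snd w"
    unfolding p_def[abs_def] q_def[abs_def] t_def[abs_def] by (intro tendsto_intros lim)+
  have "\<forall>n. \<exists>z. z \<in> K (p n) \<and> infdist (q n) (K (p n)) = dist (q n) z"
    using infdist_attains_inf[OF clK ne] by metis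
  from choice[OF this] obtain z where z: "\<And>n. z n \<in> K (p n)" "\<And>n. infdist (q n) (K (p n)) = dist (q n) (z n)"
    by blast
  have le: "dist (q n) (z n) \<le> t n" for n
    using mem[rule_format, of n] z(2)[of n] by (auto simp: epi_def p_def q_def t_def)
  obtain B1 B2 where B1: "\<And>k. norm (q k) \<le> B1" and B2: "\<And>k. norm (t k) \<le> B2"
    using convergent_imp_bounded[OF q] convergent_imp_bounded[OF t] by (auto simp: bounded_iff)
  have "norm (z k) \<le> B1 + B2" for k
    using B1[of k] B2[of k] le[of k] norm_triangle_ineq4[of "q k" "q k - z k"] by (simp add: dist_norm)
  then have "bounded (range z)" by (auto simp: bounded_iff)
  then obtain zl r where r: "strict_mono r" and "(z \<circ> r) \<longlonglongrightarrow> zl"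
    using bounded_imp_convergent_subsequence by blast
  then have zr: "(\<lambda>k. z (r k)) \<longlonglongrightarrow> zl" by (simp add: o_def)
  have pr: "(\<lambda>k. p (r k)) \<longlonglongrightarrow> fst (fst w)" and qr: "(\<lambda>k. q (r k)) \<longlonglongrightarrow> snd (fst w)"
    and tr: "(\<lambda>k. t (r k)) \<longlonglongrightarrow> snd w"
    using p q t r by (simp_all add: LIMSEQ_subseq_LIMSEQ[unfolded o_def])
  have "(\<lambda>k. (p (r k), z (r k))) \<longlonglongrightarrow> (fst (fst w), zl)" by (intro tendsto_intros pr zr)
  moreover have "\<And>k. (p (r k), z (r k)) \<in> graph K" using z(1) by (simp add: graph_def)
  ultimately have "(fst (fst w), zl) \<in> graph K" by (rule closed_sequentially[OF cl, rotated])
  then have "infdist (snd (fst w)) (K (fst (fst w))) \<le> dist (snd (fst w)) zl"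
    by (intro infdist_le) (simp add: graph_def)
  also have "\<dots> \<le> snd w"
    by (rule LIMSEQ_le[OF tendsto_dist[OF qr zr] tr]) (use le in auto)
  finally show "w \<in> epi (\<lambda>p. ereal (infdist (snd p) (K (fst p))))" by (cases w) (simp add: epi_def)
qed

section \<open>The parametric gap function and the optimality condition\<close>

lemma closed_graph_value:
  assumes "closed (graph K)"
  shows "closed (K \<xi>)"
proof -
  have "K \<xi> = Pair \<xi> -` graph K" by (auto simp: graph_def)
  also have "closed \<dots>" by (intro closed_vimage assms continuous_intros)
  finally show ?thesis .
qed

lemma gap_nu_solution:
  assumes "K \<xi> \<noteq> {}" "x \<in> sol_set f C K \<xi>"
  shows "gap_nu f C K (\<xi>, x) = 0"
proof (rule antisym)
  have "gap_nu f C K (\<xi>, x) \<le> ereal 0"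
    unfolding gap_nu_le_iff using assms(2) by (simp add: sol_set_def)
  then show "gap_nu f C K (\<xi>, x) \<le> 0" unfolding zero_ereal_def .
  show "0 \<le> gap_nu f C K (\<xi>, x)" by (rule gap_nu_nonneg[of K \<xi>, OF assms(1)])
qed

text \<open>The second factor is unconstrained, so a projection onto the product leaves the second
  coordinate alone.\<close>

lemma basic_normal_Times_UNIV:
  fixes T :: "'a::euclidean_space set" and x :: "'b::euclidean_space"
  assumes W: "W \<in> basic_normal (\<xi>, x) (T \<times> UNIV)"
  shows "fst W \<in> basic_normal \<xi> T" "snd W = 0"
proof -
  have "\<xi> \<in> T" using W by (auto simp: basic_normal_def split: if_splits)
  then obtain xs vs where xs: "xs \<longlonglongrightarrow> (\<xi>, x)" and vs: "vs \<longlonglongrightarrow> W"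
    and cone: "\<And>k. vs k \<in> proj_cone (T \<times> UNIV) (xs k)"
    using W by (auto simp: basic_normal_def)
  have *: "fst v \<in> proj_cone T (fst y) \<and> snd v = 0" if v: "v \<in> proj_cone (T \<times> UNIV) y" for v and y :: "'a \<times> 'b"
  proof -
    obtain t z where vt: "v = t *\<^sub>R (y - z)" "t \<ge> 0" and z: "z \<in> T \<times> UNIV" "dist y z = infdist y (T \<times> UNIV)"
      using v by (auto simp: proj_cone_def proj_set_def)
    have fz: "fst z \<in> T" using z by auto
    have near: "dist y z \<le> dist (fst y) e" if "e \<in> T" for e
    proof -
      have "dist y z \<le> dist y (e, snd y)" using z(2) infdist_le[of "(e, snd y)" "T \<times> UNIV" y] that by simp
      then show ?thesis by (simp add: dist_prod_def)
    qed
    have "(dist (fst y) (fst z))\<^sup>2 + (dist (snd y) (snd z))\<^sup>2 = (dist y z)\<^sup>2" by (simp add: dist_prod_def)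
    also have "\<dots> \<le> (dist (fst y) (fst z))\<^sup>2" using near[OF fz] by (intro power_mono) auto
    finally have "snd y = snd z" by simp
    have "dist (fst y) (fst z) \<le> dist (fst y) e" if "e \<in> T" for e
      using near[OF that] dist_fst_le[of y z] by linarith
    then have "infdist (fst y) T = dist (fst y) (fst z)"
      using fz by (intro antisym infdist_le) (auto simp: infdist_def intro!: cINF_greatest)
    then have "fst z \<in> proj_set (fst y) T" using fz by (simp add: proj_set_def)
    then show ?thesis using vt \<open>snd y = snd z\<close> unfolding proj_cone_def by auto
  qed
  have "(\<lambda>k. fst (xs k)) \<longlonglongrightarrow> \<xi>" "(\<lambda>k. fst (vs k)) \<longlonglongrightarrow> fst W"
    using tendsto_fst[OF xs] tendsto_fst[OF vs] by auto
  moreover have "\<forall>k. fst (vs k) \<in> proj_cone T (fst (xs k))" using * cone by blast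
  ultimately show "fst W \<in> basic_normal \<xi> T"
    using \<open>\<xi> \<in> T\<close> unfolding basic_normal_def by simp blast
  have "(\<lambda>k. snd (vs k)) \<longlonglongrightarrow> snd W" using tendsto_snd[OF vs] .
  moreover have "snd (vs k) = 0" for k using * cone by blast
  ultimately show "snd W = 0" by (simp add: LIMSEQ_const_iff)
qed

text \<open>The point \<open>q\<close> is nearest within the fibre over the same parameter, not
  within the graph. The residual is then vertical, so adding it to \<open>q'\<close> stays over the
  parameter of \<open>q'\<close> and the fibre distance there is at most its length.\<close>

lemma infdist_fibre_proj_residual:
  fixes K :: "'a::euclidean_space \<Rightarrow> 'b::euclidean_space set"
  assumes "\<And>\<xi>. closed (K \<xi>)" "\<And>\<xi>. K \<xi> \<noteq> {}"
  shows "\<exists>q\<in>graph K. dist p q = infdist (snd p) (K (fst p)) \<and>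
    (\<forall>q'\<in>graph K. infdist (snd (q' + (p - q))) (K (fst (q' + (p - q)))) \<le> infdist (snd p) (K (fst p)))"
proof -
  obtain z where z: "z \<in> K (fst p)" "infdist (snd p) (K (fst p)) = dist (snd p) z"
    using infdist_attains_inf[OF assms] by metis
  let ?q = "(fst p, z)"
  have "dist p ?q = infdist (snd p) (K (fst p))" using z(2) by (simp add: dist_prod_def)
  moreover have "infdist (snd (q' + (p - ?q))) (K (fst (q' + (p - ?q)))) \<le> infdist (snd p) (K (fst p))"
    if "q' \<in> graph K" for q'
  proof -
    have "snd q' \<in> K (fst q')" using that by (auto simp: graph_def)
    from infdist_le[OF this, of "snd q' + (snd p - z)"] show ?thesis
      using z(2) by (simp add: dist_norm)
  qed
  ultimately show ?thesis using z(1) by (intro bexI[of _ ?q]) (auto simp: graph_def)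
qed

text \<open>Test with \<open>(0, snd v)\<close>: the function is 1-Lipschitz in its second variable.
  The first component is left free and is described by the coderivative.\<close>

lemma infdist_fibre_epi_snd_bound:
  fixes K :: "'a::euclidean_space \<Rightarrow> 'b::euclidean_space set"
  assumes v: "(v, - A) \<in> prox_normal z (epi (\<lambda>p. ereal (infdist (snd p) (K (fst p)))))"
  shows "norm (snd v) \<le> A"
proof (cases "snd v = 0")
  case True
  then show ?thesis using prox_normal_epi_nonneg[of v A "fst z" "snd z"] v by simp
next
  case False
  have "v \<bullet> (0, snd v) \<le> A * norm (snd v)"
  proof (rule prox_normal_epi_direction[where e = 1 and x = "fst z" and t = "snd z"])
    fix \<tau> :: real assume \<tau>: "0 < \<tau>" "\<tau> < 1"
    have "infdist (snd (fst z) + \<tau> *\<^sub>R snd v) (K (fst (fst z)))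
        \<le> infdist (snd (fst z)) (K (fst (fst z))) + dist (snd (fst z) + \<tau> *\<^sub>R snd v) (snd (fst z))"
      by (rule infdist_triangle)
    then show "ereal (infdist (snd (fst z + \<tau> *\<^sub>R (0, snd v))) (K (fst (fst z + \<tau> *\<^sub>R (0, snd v)))))
        \<le> ereal (infdist (snd (fst z)) (K (fst (fst z)))) + ereal (\<tau> * norm (snd v))"
      using \<tau> by (simp add: dist_norm)
  qed (use v in auto)
  then have "norm (snd v) * norm (snd v) \<le> A * norm (snd v)"
    by (simp add: inner_prod_def dot_square_norm power2_eq_square)
  then show ?thesis using False by simp
qed

theorem mainTheorem10:
  fixes f :: "'a::euclidean_space \<Rightarrow> 'b::euclidean_space \<Rightarrow> 'b \<Rightarrow> 'c::euclidean_space"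
    and C :: "'c set"
    and K :: "'a \<Rightarrow> 'b set"
    and \<phi> :: "'a \<times> 'b \<Rightarrow> real"
    and \<Omega> :: "'a set"
    and \<xi>0 :: 'a and x0 :: 'b and \<rho> \<gamma> :: real
  assumes C_closed: "closed C" and C_convex: "convex C" and C_cone: "cone C"
    and C_nontriv: "C \<noteq> {}" "C \<noteq> {0}"
    and C_pointed: "C \<inter> uminus ` C = {0}"
    and K_closed_graph: "closed (graph K)"
    and K_nonempty: "\<forall>\<xi>. K \<xi> \<noteq> {}"
    and \<Omega>_closed: "closed \<Omega>"
    and locsol: "local_sol_MPEC \<phi> (sol_set f C K) \<Omega> \<xi>0 x0"
    and \<rho>_pos: "\<rho> > 0"
    and h1: "\<exists>L r. r > 0 \<and> lipschitz_on L (ball (\<xi>0, x0) r) \<phi>"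
    and h2: "usc_map K" "lsc_map K"
    and h3: "subtransversal (\<Omega> \<times> UNIV) (graph (sol_set f C K)) (\<xi>0, x0)"
    and h4: "C_usc C (\<lambda>(\<xi>, x, z). f \<xi> x z)"
    and h5: "uminus ` singular_subdiff (gap_nu f C K) (\<xi>0, x0)
               \<inter> (coderiv_set K \<xi>0 x0 (cball 0 1) \<times> cball 0 1) = {0}"
    and h6: "\<forall>\<xi>\<in>cball \<xi>0 \<rho>. \<exists>x\<xi>\<in>K \<xi>. C_bounded C ((\<lambda>z. f \<xi> x\<xi> z) ` K \<xi>)"
    and \<gamma>_pos: "\<gamma> > 0"
    and h7: "\<forall>\<xi>\<in>cball \<xi>0 \<rho>. \<forall>x. x \<notin> sol_set f C K \<xi> \<longrightarrow>
               {a + b | a b. a \<in> basic_subdiff (\<lambda>y. gap_nu f C K (\<xi>, y)) x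
                             \<and> b \<in> trunc_normal x (K \<xi>)} \<inter> cball 0 \<gamma> = {}"
  shows "\<exists>lam>0. \<exists>u w s a b.
           u \<in> basic_subdiff (\<lambda>p. ereal (\<phi> p)) (\<xi>0, x0)
         \<and> w \<in> basic_normal \<xi>0 \<Omega> \<inter> cball 0 1
         \<and> s \<in> basic_subdiff (gap_nu f C K) (\<xi>0, x0)
         \<and> a \<in> coderiv_set K \<xi>0 x0 (cball 0 1) \<and> b \<in> cball 0 1
         \<and> 0 = u + lam *\<^sub>R (w, 0) + (lam / \<gamma>) *\<^sub>R (s + (a, b))"
proof -
  define p0 where "p0 = (\<xi>0, x0)"
  define \<nu> where "\<nu> = gap_nu f C K"
  define \<mu> where "\<mu> p = infdist (snd p) (K (fst p))" for p
  define E where "E = graph (sol_set f C K)"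
  define \<Omega>' where "\<Omega>' = \<Omega> \<times> (UNIV :: 'b set)"
  have clK: "closed (K \<xi>)" and neK: "K \<xi> \<noteq> {}" for \<xi>
    using closed_graph_value[OF K_closed_graph] K_nonempty by auto
  have cl\<nu>: "closed (epi \<nu>)" unfolding \<nu>_def
    by (rule closed_epi_gap_nu[OF C_closed C_convex C_cone C_nontriv(1) h2(2) h4])
  have \<nu>_nn: "\<nu> p \<ge> 0" for p
    using gap_nu_nonneg[of K "fst p" f C "snd p"] neK by (simp add: \<nu>_def)
  obtain r2 where sol: "\<xi>0 \<in> \<Omega>" "x0 \<in> sol_set f C K \<xi>0" and r2: "r2 > 0"
    and min: "\<And>\<xi> x. \<xi> \<in> \<Omega> \<Longrightarrow> x \<in> sol_set f C K \<xi> \<Longrightarrow> (\<xi>, x) \<in> ball p0 r2 \<Longrightarrow> \<phi> p0 \<le> \<phi> (\<xi>, x)"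
    using locsol unfolding local_sol_MPEC_def p0_def by blast
  obtain L r1 where r1: "r1 > 0" and lip1: "lipschitz_on L (ball p0 r1) \<phi>"
    using h1 unfolding p0_def by blast
  obtain \<kappa> r3 where \<kappa>: "\<kappa> > 0" and r3: "r3 > 0"
    and subtr: "\<And>w. w \<in> cball p0 r3 \<Longrightarrow> infdist w (\<Omega>' \<inter> E) \<le> \<kappa> * max (infdist w \<Omega>') (infdist w E)"
    using h3 unfolding subtransversal_def p0_def \<Omega>'_def E_def by blast
  have p0\<Omega>: "p0 \<in> \<Omega>'" and p0E: "p0 \<in> E" and p0K: "p0 \<in> graph K"
    using sol by (auto simp: p0_def \<Omega>'_def E_def graph_def sol_set_def)
  have \<nu>0: "\<nu> p0 = ereal 0"
    using gap_nu_solution[OF neK sol(2)] unfolding \<nu>_def p0_def zero_ereal_def .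
  have \<mu>0: "\<mu> p0 = 0" using p0K by (auto simp: \<mu>_def p0_def graph_def)
  have L: "L \<ge> 0" using lip1 by (rule lipschitz_on_nonneg)
  define r where "r = min r1 r2"
  have r: "r > 0" using r1 r2 by (simp add: r_def)
  have lip: "lipschitz_on L (ball p0 r) \<phi>"
    by (rule lipschitz_on_subset[OF lip1]) (auto simp: r_def)
  \<comment> \<open>The three bounds serve \<open>exact_penalty\<close> (r/5 being strictly below
    r/4), subtransversality and the range of (vii).\<close>
  define R where "R = min (r / 5) (min r3 \<rho>)"
  have R: "R > 0" "R < r / 4" "R \<le> r3" "R \<le> \<rho>" using r r3 \<rho>_pos by (auto simp: R_def)
  \<comment> \<open>Lipschitz modulus of phi times subtransversality modulus; \<open>L + 1\<close>
    keeps \<open>lam\<close> positive when \<open>L = 0\<close>.\<close>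
  define lam where "lam = (L + 1) * \<kappa>"
  have lam: "lam > 0" using L \<kappa> by (simp add: lam_def)

  \<comment> \<open>The parameter is fixed and the error bound is applied in its fibre; a point of
    E(xi) then also bounds the distance to the whole graph.\<close>
  have error: "\<gamma> * infdist p E \<le> t + \<mu> p" if p: "p \<in> cball p0 R" and t: "\<nu> p \<le> ereal t" for p t
  proof -
    obtain \<xi> x where px: "p = (\<xi>, x)" by fastforce
    have "dist \<xi>0 \<xi> \<le> dist p0 p" using dist_fst_le[of p0 p] by (simp add: p0_def px)
    then have \<xi>: "\<xi> \<in> cball \<xi>0 \<rho>" using p R by simp
    have "closed (epi (\<lambda>y. \<nu> (\<xi>, y)))"
    proof -
      have "epi (\<lambda>y. \<nu> (\<xi>, y)) = (\<lambda>(y, t). ((\<xi>, y), t)) -` epi \<nu>" by (auto simp: epi_def)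
      also have "closed \<dots>" unfolding case_prod_unfold
        by (intro closed_vimage cl\<nu> continuous_intros)
      finally show ?thesis .
    qed
    then have "\<exists>y\<in>sol_set f C K \<xi>. \<gamma> * dist y x \<le> t + infdist x (K \<xi>)"
      using h7 \<xi> t \<nu>_nn \<gamma>_pos
      by (intro error_bound_from_subdifferential[where h = "\<lambda>y. \<nu> (\<xi>, y)"] clK neK) (auto simp: px \<nu>_def)
    then obtain y where y: "y \<in> sol_set f C K \<xi>" "\<gamma> * dist y x \<le> t + \<mu> p"
      by (auto simp: \<mu>_def px)
    have "infdist p E \<le> dist p (\<xi>, y)" using y(1) by (intro infdist_le) (simp add: E_def graph_def)
    also have "\<dots> = dist y x" by (simp add: px dist_Pair_Pair dist_commute)
    finally have "\<gamma> * infdist p E \<le> \<gamma> * dist y x" using \<gamma>_pos by (intro mult_left_mono) auto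
    then show ?thesis using y(2) by linarith
  qed

  \<comment> \<open>The height \<open>t\<close> stands for nu(p), which may be infinite. This is the
    minimality required by the sum rule.\<close>
  have penal: "\<phi> p0 \<le> \<phi> p + lam * infdist p \<Omega>' + (lam / \<gamma>) * t + (lam / \<gamma>) * \<mu> p"
    if p: "p \<in> cball p0 R" and t: "\<nu> p \<le> ereal t" for p t
  proof -
    have "\<phi> p0 \<le> \<phi> p + L * infdist p (\<Omega>' \<inter> E)"
    proof (rule exact_penalty[OF lip])
      show "\<phi> p0 \<le> \<phi> q" if "q \<in> \<Omega>' \<inter> E" "q \<in> ball p0 r" for q
        using that min[of "fst q" "snd q"] by (auto simp: \<Omega>'_def E_def graph_def r_def)
    qed (use p R p0\<Omega> p0E in \<open>auto simp: dist_commute\<close>)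
    also have "L * infdist p (\<Omega>' \<inter> E) \<le> (L + 1) * infdist p (\<Omega>' \<inter> E)"
      by (intro mult_right_mono) (auto simp: infdist_nonneg)
    also have "\<dots> \<le> (L + 1) * (\<kappa> * (infdist p \<Omega>' + infdist p E))"
    proof (intro mult_left_mono)
      have "infdist p (\<Omega>' \<inter> E) \<le> \<kappa> * max (infdist p \<Omega>') (infdist p E)"
        using p R by (intro subtr) auto
      also have "\<dots> \<le> \<kappa> * (infdist p \<Omega>' + infdist p E)"
        using \<kappa> infdist_nonneg[of p \<Omega>'] infdist_nonneg[of p E] by (intro mult_left_mono) auto
      finally show "infdist p (\<Omega>' \<inter> E) \<le> \<kappa> * (infdist p \<Omega>' + infdist p E)" .
    qed (use L in simp)
    also have "\<dots> = lam * infdist p \<Omega>' + lam * infdist p E" by (simp add: lam_def algebra_simps)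
    also have "lam * infdist p E \<le> lam * ((t + \<mu> p) / \<gamma>)"
      using error[OF p t] \<gamma>_pos lam by (intro mult_left_mono) (auto simp: field_simps)
    finally show ?thesis using \<gamma>_pos by (simp add: field_simps)
  qed

  \<comment> \<open>The sum rule for the four terms at the solution\<close>
  define S :: "4 \<Rightarrow> (('a \<times> 'b) \<times> real) set" where "S i = (if i = 1 then epi (\<lambda>p. ereal (\<phi> p))
      else if i = 2 then epi (\<lambda>p. ereal (infdist p \<Omega>')) else if i = 3 then epi \<nu> else epi (\<lambda>p. ereal (\<mu> p)))" for i
  define \<tau> :: "4 \<Rightarrow> real" where "\<tau> i = (if i = 1 then \<phi> p0 else 0)" for i
  define \<alpha> :: "4 \<Rightarrow> real" where "\<alpha> i = (if i = 1 then 1 else if i = 2 then lam else lam / \<gamma>)" for i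
  have S: "S 1 = epi (\<lambda>p. ereal (\<phi> p))" "S 2 = epi (\<lambda>p. ereal (infdist p \<Omega>'))" "S 3 = epi \<nu>" "S 4 = epi (\<lambda>p. ereal (\<mu> p))"
    and \<tau>: "\<tau> 1 = \<phi> p0" "\<tau> 2 = 0" "\<tau> 3 = 0" "\<tau> 4 = 0"
    and \<alpha>: "\<alpha> 1 = 1" "\<alpha> 2 = lam" "\<alpha> 3 = lam / \<gamma>" "\<alpha> 4 = lam / \<gamma>"
    by (simp_all add: S_def \<tau>_def \<alpha>_def)
  have cl\<mu>: "closed (epi (\<lambda>p. ereal (\<mu> p)))" unfolding \<mu>_def
    by (rule closed_epi_infdist_graph[OF K_closed_graph neK clK])
  \<comment> \<open>Only a local statement is available, since phi is controlled on a ball;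
    \<open>R < r / 4\<close> keeps the closed ball inside it.\<close>
  have cl\<phi>: "closed (epi (\<lambda>p. ereal (\<phi> p)) \<inter> cball (p0, \<phi> p0) R)"
  proof -
    have sub: "fst z \<in> ball p0 r" if "z \<in> cball (p0, \<phi> p0) R" for z
      using that dist_fst_le[of "(p0, \<phi> p0)" z] R r by auto
    have "continuous_on (cball (p0, \<phi> p0) R) (\<lambda>z. snd z - \<phi> (fst z))"
      by (intro continuous_intros continuous_on_compose2[OF lipschitz_on_continuous_on[OF lip]])
        (use sub in auto)
    then have "closed (cball (p0, \<phi> p0) R \<inter> (\<lambda>z. snd z - \<phi> (fst z)) -` {0..})"
      by (rule continuous_closed_preimage) auto
    moreover have "epi (\<lambda>p. ereal (\<phi> p)) \<inter> cball (p0, \<phi> p0) R = cball (p0, \<phi> p0) R \<inter> (\<lambda>z. snd z - \<phi> (fst z)) -` {0..}"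
      by (auto simp: epi_def)
    ultimately show ?thesis by simp
  qed
  obtain zs V A s W where pn: "\<And>k i. (V k i, - A k i) \<in> prox_normal (zs k i) (S i)"
    and zs: "\<And>i. (\<lambda>k. zs k i) \<longlonglongrightarrow> (p0, \<tau> i)" and V: "\<And>i. (\<lambda>k. V k i) \<longlonglongrightarrow> W i"
    and A: "\<And>i. (\<lambda>k. A k i) \<longlonglongrightarrow> s * \<alpha> i" and s: "(s::real) \<ge> 0" and sumW: "(\<Sum>i\<in>UNIV. W i) = 0"
    and s0: "s = 0 \<Longrightarrow> \<exists>i. W i \<noteq> 0"
  proof (rule decoupled_sum_rule[of R S p0 \<tau> \<alpha>])
    show "R > 0" by (rule R)
    show "closed (S i \<inter> cball (p0, \<tau> i) R)" for i
      using cl\<phi> by (auto simp: S_def \<tau>_def intro!: closed_Int cl\<nu> cl\<mu> closed_epi_continuous continuous_intros)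
    show "(p0, \<tau> i) \<in> S i" for i using p0\<Omega> \<nu>0 \<mu>0 by (auto simp: S_def \<tau>_def epi_def)
    fix p and t :: "4 \<Rightarrow> real" assume t: "\<And>i. (p, t i) \<in> S i \<inter> cball (p0, \<tau> i) R"
    have "p \<in> cball p0 R" using t[of 1] dist_fst_le[of "(p0, \<tau> 1)" "(p, t 1)"] by auto
    moreover have "\<nu> p \<le> ereal (t 3)" using t[of 3] by (simp add: S epi_def)
    ultimately have "\<phi> p0 \<le> \<phi> p + lam * infdist p \<Omega>' + (lam / \<gamma>) * t 3 + (lam / \<gamma>) * \<mu> p" by (rule penal)
    also have "\<dots> \<le> t 1 + lam * t 2 + (lam / \<gamma>) * t 3 + (lam / \<gamma>) * t 4"
      using t[of 1] t[of 2] t[of 4] lam \<gamma>_pos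
      by (intro add_mono mult_left_mono) (auto simp: S epi_def)
    finally show "(\<Sum>i\<in>UNIV. \<alpha> i * \<tau> i) \<le> (\<Sum>i\<in>UNIV. \<alpha> i * t i)"
      by (simp add: sum_4 \<tau> \<alpha>)
  qed blast
  have pn\<phi>: "(V k 1, - A k 1) \<in> prox_normal (fst (zs k 1), snd (zs k 1)) (epi (\<lambda>p. ereal (\<phi> p)))" for k
    using pn[of k 1] by (simp add: S)
  have "\<forall>\<^sub>F k in sequentially. dist (fst (zs k 1)) p0 < r / 2"
    using tendstoD[OF tendsto_fst[OF zs[of 1]], of "r / 2"] r by simp
  then have "\<forall>\<^sub>F k in sequentially. norm (V k 1) \<le> A k 1 * L"
  proof eventually_elim
    fix k assume near: "dist (fst (zs k 1)) p0 < r / 2"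
    show "norm (V k 1) \<le> A k 1 * L"
    proof (rule prox_normal_epi_lipschitz_bound[OF pn\<phi> _ L])
      show "r / 2 > 0" using r by simp
      fix y assume "dist y (fst (zs k 1)) < r / 2"
      then have "dist y p0 < r" using near dist_triangle[of y p0 "fst (zs k 1)"] by linarith
      then show "\<phi> y \<le> \<phi> (fst (zs k 1)) + L * dist y (fst (zs k 1))"
        using lipschitz_onD[OF lip, of y "fst (zs k 1)"] near r
        by (simp add: dist_commute dist_real_def)
    qed
  qed
  then have W1: "norm (W 1) \<le> s * L"
    using tendsto_le[OF sequentially_bot tendsto_mult_right[OF A[of 1], of L] tendsto_norm[OF V[of 1]]]
    by (simp add: \<alpha>)
  have "norm (V k 2) \<le> A k 2" for k using infdist_epi_bound[OF pn[of k 2, unfolded S]] .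
  then have W2: "norm (W 2) \<le> s * lam"
    using LIMSEQ_le[OF tendsto_norm[OF V[of 2]] A[of 2]] by (simp add: \<alpha>)
  have "norm (snd (V k 4)) \<le> A k 4" for k
    using infdist_fibre_epi_snd_bound[OF pn[of k 4, unfolded S \<mu>_def]] .
  then have W4: "norm (snd (W 4)) \<le> s * (lam / \<gamma>)"
    using LIMSEQ_le[OF tendsto_norm[OF tendsto_snd[OF V[of 4]]] A[of 4]] by (simp add: \<alpha>)
  have W4N: "W 4 \<in> basic_normal p0 (graph K)"
    by (rule epi_subgradient_limit_normal[OF infdist_fibre_proj_residual[OF clK neK]
          pn[of _ 4, unfolded S \<mu>_def] zs[of 4, unfolded \<tau>] V p0K])
  \<comment> \<open>The coderivative pairs u with -v, and the unit ball is symmetric, so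
    \<open>- snd Y\<close> is an admissible argument.\<close>
  have coder: "fst Y \<in> coderiv_set K \<xi>0 x0 (cball 0 1)" if "Y \<in> basic_normal p0 (graph K)" "norm (snd Y) \<le> 1" for Y
    using that unfolding coderiv_set_def coderiv_def p0_def
    by (intro UN_I[of "- snd Y"]) auto
  have sum4: "W 1 + W 2 + W 3 + W 4 = 0" using sumW by (simp add: sum_4)
  have "s \<noteq> 0"
  proof
    assume s_0: "s = 0"
    then have W12: "W 1 = 0" "W 2 = 0" and sndW: "snd (W 4) = 0" using W1 W2 W4 by auto
    then have W34: "W 4 = - W 3" using sum4 by (simp add: eq_neg_iff_add_eq_0 add.commute)
    have "W 3 \<in> singular_subdiff \<nu> p0"
      by (rule singular_subdiff_limit[OF \<nu>0 pn[of _ 3, unfolded S] zs[of 3, unfolded \<tau>] V])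
        (use A[of 3] s_0 in simp)
    then have "W 4 \<in> uminus ` singular_subdiff (gap_nu f C K) (\<xi>0, x0)"
      by (simp add: W34 \<nu>_def p0_def)
    moreover have "W 4 \<in> coderiv_set K \<xi>0 x0 (cball 0 1) \<times> cball 0 1"
      using coder[OF W4N] sndW by (simp add: mem_Times_iff)
    ultimately have "W 4 \<in> {0}" unfolding h5[symmetric] by (rule IntI)
    then have "W 4 = 0" by simp
    then have "\<forall>i. W i = 0" using W12 W34 by (simp add: forall_4)
    then show False using s0 s_0 by blast
  qed
  then have s: "s > 0" using s by simp
  \<comment> \<open>This is the common limit of the multipliers of nu and of the fibre distance, so
    one division normalises both and the factor lam/gamma comes out.\<close>
  define c where "c = s * (lam / \<gamma>)"
  have c: "c > 0" using s lam \<gamma>_pos by (simp add: c_def)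
  define u w v y where "u = (1 / s) *\<^sub>R W 1" and "w = (1 / (s * lam)) *\<^sub>R W 2"
    and "v = (1 / c) *\<^sub>R W 3" and "y = (1 / c) *\<^sub>R W 4"
  have u: "u \<in> basic_subdiff (\<lambda>p. ereal (\<phi> p)) p0" unfolding u_def
    by (rule basic_subdiff_limit[OF _ pn[of _ 1, unfolded S] zs[of 1, unfolded \<tau>] V _ s])
      (use A[of 1] in \<open>simp_all add: \<alpha>\<close>)
  have v: "v \<in> basic_subdiff \<nu> p0" unfolding v_def
    by (rule basic_subdiff_limit[OF \<nu>0 pn[of _ 3, unfolded S] zs[of 3, unfolded \<tau>] V _ c])
      (use A[of 3] in \<open>simp add: \<alpha> c_def\<close>)
  have "W 2 \<in> basic_normal p0 \<Omega>'"
  proof (rule epi_subgradient_limit_normal[OF infdist_proj_residual pn[of _ 2, unfolded S] zs[of 2, unfolded \<tau>] V p0\<Omega>])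
    show "closed \<Omega>'" unfolding \<Omega>'_def by (intro closed_Times \<Omega>_closed closed_UNIV)
    show "\<Omega>' \<noteq> {}" using p0\<Omega> by blast
  qed
  then have "w \<in> basic_normal p0 \<Omega>'" unfolding w_def using s lam by (intro basic_normal_scale) auto
  then have w: "fst w \<in> basic_normal \<xi>0 \<Omega>" "snd w = 0"
    using basic_normal_Times_UNIV[of w \<xi>0 x0 \<Omega>] by (auto simp: p0_def \<Omega>'_def)
  have "norm w \<le> 1" using W2 s lam by (simp add: w_def field_simps)
  then have nw: "norm (fst w) \<le> 1" using norm_fst_le[of "fst w" "snd w"] by simp
  have "norm (snd y) \<le> 1" using W4[folded c_def] c by (simp add: y_def field_simps)
  moreover have "y \<in> basic_normal p0 (graph K)" unfolding y_def using c W4N by (intro basic_normal_scale) auto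
  ultimately have y: "fst y \<in> coderiv_set K \<xi>0 x0 (cball 0 1)" "norm (snd y) \<le> 1" using coder by auto
  have "u + lam *\<^sub>R w + (lam / \<gamma>) *\<^sub>R (v + y) = (1 / s) *\<^sub>R (W 1 + W 2 + W 3 + W 4)"
    using s lam \<gamma>_pos by (simp add: u_def w_def v_def y_def c_def scaleR_add_right)
  then have "0 = u + lam *\<^sub>R (fst w, 0) + (lam / \<gamma>) *\<^sub>R (v + (fst y, snd y))"
    using sum4 w(2) by (metis prod.collapse scaleR_zero_right)
  then show ?thesis
    using lam u v w nw y unfolding \<nu>_def p0_def
    by (intro exI[of _ lam] conjI exI[of _ u] exI[of _ "fst w"] exI[of _ v] exI[of _ "fst y"] exI[of _ "snd y"]) auto
qed

end
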